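(* Let $\mathcal S \subseteq 2^\omega$ be a Scott set and let $A \in \mathcal S$. Then either there is $X \in \mathcal S$ that is weakly 2-random relative to $A$, or there is $X \in \mathcal S$ that is 1-generic relative to $A$.
   Context: A Scott set is a nonempty set $\mathcal S \subseteq 2^\omega$ closed under Turing reducibility (if $Y \le_T X \in \mathcal S$ then $Y \in \mathcal S$) and under joins $X \oplus Y$, and such that every infinite binary tree computable from an element of $\mathcal S$ has an infinite path in $\mathcal S$. A set $X$ is weakly 2-random relative to $A$ if $X$ does not belong to any $\Pi^0_2(A)$ class of Lebesgue measure $0$. A set $X$ is 1-generic relative to $A$ if for every set $W$ of finite binary strings that is c.e. in $A$, either some initial segment of $X$ lies in $W$, or some initial segment of $X$ has no extension in $W$. *)

theory Defs
  imports "HOL-Probability.Probability" "HOL-Library.Nat_Bijection"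
begin

text \<open>Elements of Cantor space 2^omega are functions nat => bool.
  Oracle computability: partial recursive functions (Kleene) with an oracle.\<close>

datatype recf = Zer | Suc_f | Proj nat | Orac | Comp recf "recf list"
  | Prim recf recf | Mu recf

inductive eval :: "(nat \<Rightarrow> bool) \<Rightarrow> recf \<Rightarrow> nat list \<Rightarrow> nat \<Rightarrow> bool"
  for A :: "nat \<Rightarrow> bool" where
  zer: "eval A Zer xs 0"
| suc: "eval A Suc_f (x # xs) (Suc x)"
| proj: "i < length xs \<Longrightarrow> eval A (Proj i) xs (xs ! i)"
| orac: "eval A Orac (x # xs) (if A x then 1 else 0)"
| comp: "list_all2 (\<lambda>g y. eval A g xs y) gs ys \<Longrightarrow> eval A f ys z
          \<Longrightarrow> eval A (Comp f gs) xs z"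
| prim0: "eval A f xs z \<Longrightarrow> eval A (Prim f g) (0 # xs) z"
| primS: "eval A (Prim f g) (n # xs) y \<Longrightarrow> eval A g (y # n # xs) z
          \<Longrightarrow> eval A (Prim f g) (Suc n # xs) z"
| mu: "eval A f (n # xs) 0 \<Longrightarrow> (\<forall>m<n. \<exists>y. y > 0 \<and> eval A f (m # xs) y)
          \<Longrightarrow> eval A (Mu f) xs n"

definition turing_red :: "(nat \<Rightarrow> bool) \<Rightarrow> (nat \<Rightarrow> bool) \<Rightarrow> bool" where
  "turing_red Y X \<longleftrightarrow> (\<exists>f. \<forall>n. eval X f [n] (if Y n then 1 else 0))"

definition join :: "(nat \<Rightarrow> bool) \<Rightarrow> (nat \<Rightarrow> bool) \<Rightarrow> nat \<Rightarrow> bool" where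
  "join X Y n = (if even n then X (n div 2) else Y (n div 2))"

text \<open>Bijective coding of finite binary strings by natural numbers\<close>
fun bl_code :: "bool list \<Rightarrow> nat" where
  "bl_code [] = 0"
| "bl_code (b # bs) = 2 * bl_code bs + (if b then 2 else 1)"

definition pref :: "(nat \<Rightarrow> bool) \<Rightarrow> nat \<Rightarrow> bool list" where
  "pref X n = map X [0..<n]"

definition binary_tree :: "bool list set \<Rightarrow> bool" where
  "binary_tree T \<longleftrightarrow> (\<forall>\<sigma> \<tau>. \<sigma> @ \<tau> \<in> T \<longrightarrow> \<sigma> \<in> T)"

definition is_path :: "(nat \<Rightarrow> bool) \<Rightarrow> bool list set \<Rightarrow> bool" where
  "is_path P T \<longleftrightarrow> (\<forall>n. pref P n \<in> T)"

definition scott_set :: "(nat \<Rightarrow> bool) set \<Rightarrow> bool" where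
  "scott_set S \<longleftrightarrow> S \<noteq> {}
    \<and> (\<forall>X\<in>S. \<forall>Y. turing_red Y X \<longrightarrow> Y \<in> S)
    \<and> (\<forall>X\<in>S. \<forall>Y\<in>S. join X Y \<in> S)
    \<and> (\<forall>X\<in>S. \<forall>T. binary_tree T \<and> infinite T
          \<and> turing_red (\<lambda>k. \<exists>\<sigma>\<in>T. bl_code \<sigma> = k) X
          \<longrightarrow> (\<exists>P\<in>S. is_path P T))"

definition cantor_measure :: "(nat \<Rightarrow> bool) measure" where
  "cantor_measure = PiM UNIV (\<lambda>_. measure_pmf (bernoulli_pmf (1/2)))"

definition pi02_class :: "(nat \<Rightarrow> bool) \<Rightarrow> (nat \<Rightarrow> bool) set" where
  "pi02_class R = {Y. \<forall>n. \<exists>m. R (prod_encode (n, bl_code (pref Y m)))}"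

definition is_pi02_rel :: "(nat \<Rightarrow> bool) \<Rightarrow> (nat \<Rightarrow> bool) set \<Rightarrow> bool" where
  "is_pi02_rel A C \<longleftrightarrow> (\<exists>R. turing_red R A \<and> C = pi02_class R)"

definition weakly_2_random_rel :: "(nat \<Rightarrow> bool) \<Rightarrow> (nat \<Rightarrow> bool) \<Rightarrow> bool" where
  "weakly_2_random_rel A X \<longleftrightarrow>
     (\<forall>C. is_pi02_rel A C \<and> C \<in> null_sets cantor_measure \<longrightarrow> X \<notin> C)"

definition ce_in :: "(nat \<Rightarrow> bool) \<Rightarrow> bool list set \<Rightarrow> bool" where
  "ce_in A W \<longleftrightarrow> (\<exists>f. \<forall>\<sigma>. \<sigma> \<in> W \<longleftrightarrow> (\<exists>y. eval A f [bl_code \<sigma>] y))"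

definition one_generic_rel :: "(nat \<Rightarrow> bool) \<Rightarrow> (nat \<Rightarrow> bool) \<Rightarrow> bool" where
  "one_generic_rel A X \<longleftrightarrow>
     (\<forall>W. ce_in A W \<longrightarrow>
        (\<exists>n. pref X n \<in> W) \<or> (\<exists>n. \<forall>\<tau>\<in>W. \<not> (\<exists>\<rho>. \<tau> = pref X n @ \<rho>)))"

end

theory Submission
  imports Defs
begin

text \<open>
  For every index \<open>k\<close> of a \<open>\<Pi>\<^sup>0\<^sub>2(A)\<close> class \<open>\<Inter>\<^sub>n U\<^sub>n\<close> we run, computably in \<open>A\<close>, a finite-injury
  construction of a sequence \<open>G\<close> that is 1-generic relative to \<open>A\<close>. The requirement for the \<open>e\<close>-th
  c.e. set may change \<open>G\<close> at positions \<open>\<ge> n\<close> only while the part of \<open>U\<^sub>0 \<inter> \<dots> \<inter> U\<^sub>n\<close> enumerated so far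
  has measure at most \<open>4\<^bsup>-e\<^esup> 2\<^bsup>-k-3\<^esup>\<close>, and that part is then declared bad. All bad sets together,
  over all \<open>k\<close>, have measure below 1, whether or not the classes are null, so the complement contains
  the paths of an infinite \<open>A\<close>-computable tree, and the Scott set has such a path \<open>X\<close>.

  If \<open>X\<close> is not weakly 2-random relative to \<open>A\<close>, it lies in a null class \<open>\<Inter>\<^sub>n U\<^sub>n\<close>. Once \<open>X\<close> has been seen
  to enter \<open>U\<^sub>0 \<inter> \<dots> \<inter> U\<^sub>x\<close>, no later change of \<open>G\<close> at \<open>x\<close> is possible, since it would put \<open>X\<close> into a bad
  set; so \<open>X \<oplus> A\<close> computes the limit of \<open>G\<close>. As the class is null, the measures of
  \<open>U\<^sub>0 \<inter> \<dots> \<inter> U\<^sub>n\<close> tend to 0, so every requirement is eventually allowed to act.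
\<close>

section \<open>Computable functions between encoded types\<close>

lemma eval_Comp1: "eval A g xs y \<Longrightarrow> eval A f [y] z \<Longrightarrow> eval A (Comp f [g]) xs z"
  by (rule eval.comp[of A xs "[g]" "[y]"]) auto

lemma eval_Comp2:
  "eval A g xs y \<Longrightarrow> eval A h xs y' \<Longrightarrow> eval A f [y, y'] z \<Longrightarrow> eval A (Comp f [g, h]) xs z"
  by (rule eval.comp[of A xs "[g, h]" "[y, y']"]) auto

lemma eval_Proj: "i < length xs \<Longrightarrow> y = xs ! i \<Longrightarrow> eval A (Proj i) xs y"
  using eval.proj by simp

lemma eval_Suc_f: "y = Suc x \<Longrightarrow> eval A Suc_f (x # xs) y"
  using eval.suc by simp

lemma eval_Prim:
  assumes "eval A f xs (h 0)" "\<And>n. eval A g (h n # n # xs) (h (Suc n))"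
  shows "eval A (Prim f g) (n # xs) (h n)"
  by (induction n) (auto intro: assms eval.prim0 eval.primS)

lemma eval_Mu_Least:
  assumes "\<And>n. eval A f (n # xs) (h n)" "h m = 0"
  shows "eval A (Mu f) xs (LEAST n. h n = 0)"
proof (rule eval.mu)
  show "eval A f ((LEAST n. h n = 0) # xs) 0"
    using assms(1)[of "LEAST n. h n = 0"] LeastI[of "\<lambda>n. h n = 0", OF assms(2)] by simp
  show "\<forall>i<(LEAST n. h n = 0). \<exists>y>0. eval A f (i # xs) y"
    using assms(1) not_less_Least by blast
qed

fun const_prog :: "nat \<Rightarrow> recf" where
  "const_prog 0 = Zer"
| "const_prog (Suc n) = Comp Suc_f [const_prog n]"

lemma eval_const_prog: "eval A (const_prog n) xs n"
  by (induction n) (auto intro: eval.zer eval_Comp1 eval_Suc_f)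

definition "plus_prog = Prim (Proj 0) (Comp Suc_f [Proj 0])"
definition "pred_prog = Prim Zer (Proj 1)"
text \<open>Primitive recursion runs over the first argument, so the subtrahend comes first:
  \<open>[m, n]\<close> is sent to \<open>n - m\<close>.\<close>

definition "sub_prog = Prim (Proj 0) (Comp pred_prog [Proj 0])"
definition "triangle_prog = Prim Zer (Comp plus_prog [Proj 0, Comp Suc_f [Proj 1]])"
definition "pair_prog = Comp plus_prog [Comp triangle_prog [plus_prog], Proj 0]"
text \<open>On \<open>z = prod_encode (m, n) = triangle (m + n) + m\<close> this finds the least
  \<open>d\<close> with \<open>z < triangle (Suc d)\<close>, which is the diagonal
  \<open>m + n\<close>. Both components are then differences.\<close>

definition "diag_prog =
  Mu (Comp sub_prog [Comp triangle_prog [Comp Suc_f [Proj 0]], Comp Suc_f [Proj 1]])"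
definition "fst_prog = Comp sub_prog [Comp triangle_prog [diag_prog], Proj 0]"
definition "snd_prog = Comp sub_prog [fst_prog, diag_prog]"

lemma eval_plus_prog: "eval A plus_prog [m, n] (m + n)"
  unfolding plus_prog_def
  by (rule eval_Prim[where h="\<lambda>m. m + n"]) (auto intro!: eval_Proj eval_Comp1 eval_Suc_f)

lemma eval_pred_prog: "eval A pred_prog [n] (n - 1)"
  unfolding pred_prog_def
  by (rule eval_Prim[where h="\<lambda>n. n - 1"]) (auto intro!: eval_Proj eval.zer)

lemma eval_sub_prog: "eval A sub_prog [m, n] (n - m)"
  unfolding sub_prog_def
proof (rule eval_Prim[where h="\<lambda>m. n - m"])
  show "eval A (Comp pred_prog [Proj 0]) [n - k, k, n] (n - Suc k)" for k
    using eval_Comp1[OF eval_Proj eval_pred_prog, of 0 "[n - k, k, n]" "n - k"] by simp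
qed (auto intro: eval_Proj)

lemma eval_triangle_prog: "eval A triangle_prog [n] (triangle n)"
  unfolding triangle_prog_def
proof (rule eval_Prim[where h=triangle])
  show "eval A (Comp plus_prog [Proj 0, Comp Suc_f [Proj 1]]) [triangle k, k] (triangle (Suc k))" for k
    unfolding triangle_Suc by (rule eval_Comp2[OF _ _ eval_plus_prog]) (auto intro!: eval_Proj eval_Comp1 eval_Suc_f)
qed (auto intro: eval.zer)

lemma eval_pair_prog: "eval A pair_prog [m, n] (prod_encode (m, n))"
  unfolding pair_prog_def prod_encode_def
  by simp (rule eval_Comp2[OF eval_Comp1[OF eval_plus_prog eval_triangle_prog] _ eval_plus_prog],
      auto intro: eval_Proj)

lemma triangle_mono: "a \<le> b \<Longrightarrow> triangle a \<le> triangle b"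
  unfolding triangle_def by (intro div_le_mono mult_le_mono) auto

lemma Least_triangle:
  assumes "m \<le> k" shows "(LEAST d. Suc (triangle k + m) - triangle (Suc d) = 0) = k"
proof (rule Least_equality)
  fix d assume "Suc (triangle k + m) - triangle (Suc d) = 0"
  then have "triangle k < triangle (Suc d)" by simp
  then show "k \<le> d" using triangle_mono[of "Suc d" k] by (meson leD not_less_eq_eq)
qed (use assms in auto)

lemma eval_diag_prog: "eval A diag_prog [prod_encode (m, n)] (m + n)"
proof -
  let ?z = "prod_encode (m, n)"
  have "eval A diag_prog [?z] (LEAST d. Suc ?z - triangle (Suc d) = 0)"
    unfolding diag_prog_def
  proof (rule eval_Mu_Least)
    show "eval A (Comp sub_prog [Comp triangle_prog [Comp Suc_f [Proj 0]], Comp Suc_f [Proj 1]]) [d, ?z]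
        (Suc ?z - triangle (Suc d))" for d
      by (rule eval_Comp2[OF eval_Comp1[OF _ eval_triangle_prog] _ eval_sub_prog])
        (auto intro!: eval_Comp1 eval_Proj eval_Suc_f)
    show "Suc ?z - triangle (Suc (m + n)) = 0" by (simp add: prod_encode_def)
  qed
  then show ?thesis using Least_triangle[of m "m + n"] by (simp add: prod_encode_def del: triangle_Suc)
qed

lemma eval_fst_prog: "eval A fst_prog [prod_encode (m, n)] m"
proof -
  have "eval A fst_prog [prod_encode (m, n)] (prod_encode (m, n) - triangle (m + n))"
    unfolding fst_prog_def
    by (rule eval_Comp2[OF eval_Comp1[OF eval_diag_prog eval_triangle_prog] _ eval_sub_prog])
      (auto intro: eval_Proj)
  then show ?thesis by (simp add: prod_encode_def)
qed

lemma eval_snd_prog: "eval A snd_prog [prod_encode (m, n)] n"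
  using eval_Comp2[OF eval_fst_prog eval_diag_prog eval_sub_prog, of A m n]
  by (simp add: snd_prog_def)

text \<open>Encodings need not be surjective, and a program computing a function is unconstrained on
  numbers that are not codes.\<close>

class code =
  fixes enc :: "'a \<Rightarrow> nat"
  assumes inj_enc: "inj enc"

lemma enc_eq_iff [simp]: "enc x = enc y \<longleftrightarrow> x = y"
  by (rule inj_eq[OF inj_enc])

instantiation nat :: code
begin
definition enc_nat_def [simp]: "enc (n :: nat) = n"
instance by standard (simp add: inj_def)
end

instantiation bool :: code
begin
definition enc_bool_def: "enc (b :: bool) = (if b then 1 else 0 :: nat)"
instance by standard (simp add: inj_def enc_bool_def)
end

instantiation prod :: (code, code) code
begin
definition enc_prod_def: "enc p = prod_encode (enc (fst p), enc (snd p))"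
instance by standard (auto simp: inj_def enc_prod_def)
end

instantiation list :: (code) code
begin
definition enc_list_def: "enc xs = list_encode (map enc xs)"
instance by standard (auto simp: inj_def enc_list_def list_encode_eq inj_map_eq_map[OF inj_enc])
end

lemma enc_Nil [simp]: "enc [] = 0"
  and enc_Cons: "enc (x # xs) = Suc (enc (x, xs))"
  by (simp_all add: enc_list_def enc_prod_def)

text \<open>Allows the code of a list to serve as the number of steps in a traversal of the
  list.\<close>

lemma length_le_enc: "length xs \<le> enc xs"
proof (induction xs)
  case (Cons x xs)
  then show ?case using le_prod_encode_2[of "enc xs" "enc x"] by (simp add: enc_Cons enc_prod_def)
qed simp

section \<open>Computable functions and their closure rules\<close>

definition computable :: "(nat \<Rightarrow> bool) \<Rightarrow> ('a::code \<Rightarrow> 'b::code) \<Rightarrow> bool" where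
  "computable A f \<longleftrightarrow> (\<exists>r. \<forall>x. eval A r [enc x] (enc (f x)))"

lemma computableI: "(\<And>x. eval A r [enc x] (enc (f x))) \<Longrightarrow> computable A f"
  unfolding computable_def by blast

lemma computableE:
  assumes "computable A f" obtains r where "\<And>x. eval A r [enc x] (enc (f x))"
  using assms unfolding computable_def by blast

text \<open>The rules carry a parameter \<open>x\<close>, and a function under a binder is assumed
  computable on the tuple of \<open>x\<close> and its bound variables. Computability proofs can
  therefore follow the syntax of a term.\<close>

named_theorems comp_intros

lemma computable_const [comp_intros]: "computable A (\<lambda>x. c)"
  by (rule computableI[of _ "const_prog (enc c)"]) (rule eval_const_prog)

lemma computable_id [comp_intros]: "computable A (\<lambda>x. x)"
  by (rule computableI[of _ "Proj 0"]) (simp add: eval_Proj)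

lemma computable_compose:
  assumes "computable A g" "computable A f" shows "computable A (\<lambda>x. g (f x))"
proof -
  obtain r s where "\<And>x. eval A r [enc x] (enc (f x))" "\<And>x. eval A s [enc x] (enc (g x))"
    using assms by (metis computableE)
  then show ?thesis by (intro computableI[of _ "Comp s [r]"]) (rule eval_Comp1)
qed

lemma computable_Pair [comp_intros]:
  assumes "computable A f" "computable A g" shows "computable A (\<lambda>x. (f x, g x))"
proof -
  obtain r s where "\<And>x. eval A r [enc x] (enc (f x))" "\<And>x. eval A s [enc x] (enc (g x))"
    using assms by (metis computableE)
  then show ?thesis
    by (intro computableI[of _ "Comp pair_prog [r, s]"])
      (auto simp: enc_prod_def intro: eval_Comp2 eval_pair_prog)
qed

lemma computable_fst [comp_intros]: "computable A f \<Longrightarrow> computable A (\<lambda>x. fst (f x))"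
  by (rule computable_compose, rule computableI[of _ fst_prog]) (auto simp: enc_prod_def eval_fst_prog)

lemma computable_snd [comp_intros]: "computable A f \<Longrightarrow> computable A (\<lambda>x. snd (f x))"
  by (rule computable_compose, rule computableI[of _ snd_prog]) (auto simp: enc_prod_def eval_snd_prog)

lemma computable_case_prod [comp_intros]:
  assumes "computable A f" "computable A (\<lambda>p. g (fst p) (fst (snd p)) (snd (snd p)))"
  shows "computable A (\<lambda>x. case f x of (a, b) \<Rightarrow> g x a b)"
  using computable_compose[OF assms(2) computable_Pair[OF computable_id assms(1)]]
  by (simp add: case_prod_beta)

text \<open>As \<open>enc\<close> is the identity on \<open>nat\<close>, a value and its code are
  represented by the same number, and the identity program converts one to the other.\<close>

lemma computable_enc [comp_intros]: "computable A f \<Longrightarrow> computable A (\<lambda>x. enc (f x))"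
  by (rule computable_compose, rule computableI[of _ "Proj 0"]) (auto intro: eval_Proj)

lemma computable_Suc [comp_intros]: "computable A f \<Longrightarrow> computable A (\<lambda>x. Suc (f x))"
  by (rule computable_compose, rule computableI[of _ Suc_f]) (auto intro: eval_Suc_f)

lemma computable_oracle [comp_intros]: "computable A f \<Longrightarrow> computable A (\<lambda>x. A (f x))"
  by (rule computable_compose[of A A], rule computableI[of _ Orac])
    (use eval.orac[of A _ "[]"] in \<open>auto simp: enc_bool_def\<close>)

lemma computable_rec_nat [comp_intros]:
  assumes "computable A a" "computable A b"
    "computable A (\<lambda>p. g (fst p) (fst (snd p)) (snd (snd p)))"
  shows "computable A (\<lambda>x. rec_nat (a x) (g x) (b x))"
proof -
  obtain ra where ra: "\<And>x. eval A ra [enc x] (enc (a x))"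
    using assms(1) unfolding computable_def by blast
  obtain rb where rb: "\<And>x. eval A rb [enc x] (enc (b x))"
    using assms(2) unfolding computable_def by blast
  obtain rg where rg: "\<And>p. eval A rg [enc p] (enc (g (fst p) (fst (snd p)) (snd (snd p))))"
    using assms(3) unfolding computable_def by blast
  note r = ra rb rg
  \<comment> \<open>\<open>Prim\<close> supplies the previous value, the counter and the parameter,
    in this order; the projections repack them as the code of \<open>(x, n, y)\<close>.\<close>
  let ?g = "Comp rg [Comp pair_prog [Proj 2, Comp pair_prog [Proj 1, Proj 0]]]"
  have "eval A (Prim ra ?g) [n, enc x] (enc (rec_nat (a x) (g x) n))" for n x
  proof (rule eval_Prim[where h="\<lambda>n. enc (rec_nat (a x) (g x) n)"])
    fix n
    let ?y = "rec_nat (a x) (g x) n"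
    have "eval A (Comp pair_prog [Proj 2, Comp pair_prog [Proj 1, Proj 0]]) [enc ?y, n, enc x] (enc (x, n, ?y))"
      unfolding enc_prod_def fst_conv snd_conv
      by (rule eval_Comp2[OF _ eval_Comp2[OF _ _ eval_pair_prog] eval_pair_prog])
        (auto intro!: eval_Proj)
    from eval_Comp1[OF this] show "eval A ?g [enc ?y, n, enc x] (enc (rec_nat (a x) (g x) (Suc n)))"
      using r(3)[of "(x, n, ?y)"] by simp
  qed (simp add: r)
  then show ?thesis
    by (intro computableI[of _ "Comp (Prim ra ?g) [rb, Proj 0]"] eval_Comp2[OF r(2) eval_Proj]) auto
qed

lemma computable_Least [comp_intros]:
  assumes "computable A (\<lambda>p. P (fst p) (snd p))" "\<And>x. \<exists>n. P x n"
  shows "computable A (\<lambda>x. LEAST n::nat. P x n)"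
proof -
  obtain r where r: "\<And>p. eval A r [enc p] (enc (P (fst p) (snd p)))"
    using assms(1) unfolding computable_def by blast
  \<comment> \<open>\<open>Mu\<close> looks for a zero while truth is encoded by 1, hence the
    subtraction from 1.\<close>
  let ?f = "Comp sub_prog [Comp r [Comp pair_prog [Proj 1, Proj 0]], const_prog 1]"
  have "eval A (Mu ?f) [enc x] (LEAST n. 1 - enc (P x n) = 0)" for x
  proof -
    obtain m where m: "P x m" using assms(2) by blast
    show ?thesis
    proof (rule eval_Mu_Least[of _ _ _ _ m])
      fix n
      have "eval A (Comp pair_prog [Proj 1, Proj 0]) [n, enc x] (enc (x, n))"
        unfolding enc_prod_def fst_conv snd_conv
        by (rule eval_Comp2[OF _ _ eval_pair_prog]) (auto intro!: eval_Proj)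
      from eval_Comp1[OF this] show "eval A ?f [n, enc x] (1 - enc (P x n))"
        by (intro eval_Comp2[OF _ eval_const_prog eval_sub_prog]) (use r[of "(x, n)"] in simp)
    qed (simp add: m enc_bool_def)
  qed
  moreover have "(1 - enc (P x n) = 0) = P x n" for x n by (simp add: enc_bool_def)
  ultimately show ?thesis by (intro computableI[of _ "Mu ?f"]) simp
qed

lemma computable_case_nat [comp_intros]:
  assumes "computable A a" "computable A b" "computable A (\<lambda>p. g (fst p) (snd p))"
  shows "computable A (\<lambda>x. case b x of 0 \<Rightarrow> a x | Suc n \<Rightarrow> g x n)"
proof -
  have "computable A (\<lambda>x. rec_nat (a x) (\<lambda>n _. g x n) (b x))"
    by (intro comp_intros assms computable_compose[OF assms(3), of "\<lambda>p. (fst p, fst (snd p))", simplified])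
  moreover have "rec_nat (a x) (\<lambda>n _. g x n) (b x) = (case b x of 0 \<Rightarrow> a x | Suc n \<Rightarrow> g x n)" for x
    by (cases "b x") auto
  ultimately show ?thesis by simp
qed

lemma computable_If [comp_intros]:
  assumes "computable A c" "computable A a" "computable A b"
  shows "computable A (\<lambda>x. if c x then a x else b x)"
proof -
  have "computable A (\<lambda>x. case enc (c x) of 0 \<Rightarrow> b x | Suc n \<Rightarrow> a x)"
    by (intro comp_intros assms computable_compose[OF assms(2)])
  moreover have "(case enc (c x) of 0 \<Rightarrow> b x | Suc n \<Rightarrow> a x) = (if c x then a x else b x)" for x
    by (simp add: enc_bool_def)
  ultimately show ?thesis by simp
qed

lemma computable_conj [comp_intros]:
  assumes "computable A P" "computable A Q" shows "computable A (\<lambda>x. P x \<and> Q x)"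
proof -
  have "computable A (\<lambda>x. if P x then Q x else False)" by (intro comp_intros assms)
  moreover have "(\<lambda>x. if P x then Q x else False) = (\<lambda>x. P x \<and> Q x)" by auto
  ultimately show ?thesis by (simp only:)
qed

lemma computable_not [comp_intros]:
  assumes "computable A P" shows "computable A (\<lambda>x. \<not> P x)"
proof -
  have "computable A (\<lambda>x. if P x then False else True)" by (intro comp_intros assms)
  moreover have "(\<lambda>x. if P x then False else True) = (\<lambda>x. \<not> P x)" by auto
  ultimately show ?thesis by (simp only:)
qed

lemma computable_disj [comp_intros]:
  assumes "computable A P" "computable A Q" shows "computable A (\<lambda>x. P x \<or> Q x)"
proof -
  have "computable A (\<lambda>x. \<not> (\<not> P x \<and> \<not> Q x))" by (intro comp_intros assms)
  then show ?thesis by simp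
qed

lemma computable_imp [comp_intros]:
  assumes "computable A P" "computable A Q" shows "computable A (\<lambda>x. P x \<longrightarrow> Q x)"
  unfolding imp_conv_disj by (intro comp_intros assms)

lemma computable_add [comp_intros]:
  assumes "computable A f" "computable A g" shows "computable A (\<lambda>x. f x + g x :: nat)"
proof -
  have "computable A (\<lambda>x. rec_nat (f x) (\<lambda>_. Suc) (g x))" by (intro comp_intros assms)
  moreover have "rec_nat a (\<lambda>_. Suc) b = a + b" for a b by (induction b) auto
  ultimately show ?thesis by simp
qed

lemma computable_diff [comp_intros]:
  assumes "computable A f" "computable A g" shows "computable A (\<lambda>x. f x - g x :: nat)"
proof -
  have "computable A (\<lambda>x. rec_nat (f x) (\<lambda>_ y. case y of 0 \<Rightarrow> 0 | Suc z \<Rightarrow> z) (g x))"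
    by (intro comp_intros assms)
  moreover have "rec_nat a (\<lambda>_ y. case y of 0 \<Rightarrow> 0 | Suc z \<Rightarrow> z) b = a - b" for a b :: nat
    by (induction b) (auto split: nat.split)
  ultimately show ?thesis by simp
qed

lemma computable_mult [comp_intros]:
  assumes "computable A f" "computable A g" shows "computable A (\<lambda>x. f x * g x :: nat)"
proof -
  have "computable A (\<lambda>x. rec_nat 0 (\<lambda>_ y. f x + y) (g x))"
    by (intro comp_intros assms computable_compose[OF assms(1)])
  moreover have "rec_nat 0 (\<lambda>_ y. a + y) b = a * b" for a b :: nat by (induction b) auto
  ultimately show ?thesis by simp
qed

lemma computable_power [comp_intros]:
  assumes "computable A f" "computable A g" shows "computable A (\<lambda>x. f x ^ g x :: nat)"
proof -
  have "computable A (\<lambda>x. rec_nat 1 (\<lambda>_ y. f x * y) (g x))"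
    by (intro comp_intros assms computable_compose[OF assms(1)])
  moreover have "rec_nat 1 (\<lambda>_ y. a * y) b = a ^ b" for a b :: nat by (induction b) auto
  ultimately show ?thesis by simp
qed

lemma computable_le [comp_intros]:
  assumes "computable A f" "computable A g" shows "computable A (\<lambda>x. f x \<le> (g x :: nat))"
proof -
  have "computable A (\<lambda>x. case f x - g x of 0 \<Rightarrow> True | Suc _ \<Rightarrow> False)"
    by (intro comp_intros assms)
  moreover have "(case a - b of 0 \<Rightarrow> True | Suc _ \<Rightarrow> False) \<longleftrightarrow> a \<le> b" for a b :: nat
    by (auto split: nat.split)
  ultimately show ?thesis by simp
qed

lemma computable_less [comp_intros]:
  assumes "computable A f" "computable A g" shows "computable A (\<lambda>x. f x < (g x :: nat))"
  using computable_le[OF computable_Suc assms(2), OF assms(1)] by (simp add: Suc_le_eq)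

lemma computable_eq [comp_intros]:
  assumes "computable A f" "computable A g" shows "computable A (\<lambda>x. f x = g x)"
proof -
  have "computable A (\<lambda>x. enc (f x) \<le> enc (g x) \<and> enc (g x) \<le> enc (f x))"
    by (intro comp_intros assms)
  then show ?thesis by (simp add: order_antisym_conv eq_iff[symmetric])
qed

lemma computable_all_less [comp_intros]:
  assumes "computable A b" "computable A (\<lambda>p. P (fst p) (snd p))"
  shows "computable A (\<lambda>x. \<forall>i<b x :: nat. P x i)"
proof -
  have "computable A (\<lambda>x. rec_nat True (\<lambda>i y. y \<and> P x i) (b x))"
    by (intro comp_intros assms computable_compose[OF assms(2), of "\<lambda>p. (fst p, fst (snd p))", simplified])
  moreover have "rec_nat True (\<lambda>i y. y \<and> Q i) n \<longleftrightarrow> (\<forall>i<n. Q i)" for Q n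
    by (induction n) (auto simp: less_Suc_eq)
  ultimately show ?thesis by simp
qed

lemma computable_ex_less [comp_intros]:
  assumes "computable A b" "computable A (\<lambda>p. P (fst p) (snd p))"
  shows "computable A (\<lambda>x. \<exists>i<b x :: nat. P x i)"
proof -
  have "computable A (\<lambda>x. \<not> (\<forall>i<b x. \<not> P x i))" by (intro comp_intros assms)
  then show ?thesis by simp
qed

lemma computable_all_le [comp_intros]:
  assumes "computable A b" "computable A (\<lambda>p. P (fst p) (snd p))"
  shows "computable A (\<lambda>x. \<forall>i\<le>b x :: nat. P x i)"
proof -
  have "computable A (\<lambda>x. \<forall>i<Suc (b x). P x i)" by (intro comp_intros assms)
  then show ?thesis by (simp add: less_Suc_eq_le)
qed

lemma computable_ex_le [comp_intros]:
  assumes "computable A b" "computable A (\<lambda>p. P (fst p) (snd p))"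
  shows "computable A (\<lambda>x. \<exists>i\<le>b x :: nat. P x i)"
proof -
  have "computable A (\<lambda>x. \<exists>i<Suc (b x). P x i)" by (intro comp_intros assms)
  then show ?thesis by (simp add: less_Suc_eq_le)
qed

lemma computable_Cons [comp_intros]:
  assumes "computable A f" "computable A g" shows "computable A (\<lambda>x. f x # g x)"
proof -
  have "computable A (\<lambda>x. Suc (enc (f x, g x)))" by (intro comp_intros assms)
  then show ?thesis by (simp add: computable_def enc_Cons)
qed

text \<open>The program of the second branch may diverge on arguments that are not codes; primitive
  recursion up to the sign of the code of the list runs it only on a nonempty list.\<close>

lemma computable_case_list [comp_intros]:
  assumes "computable A l" "computable A a"
    "computable A (\<lambda>p. g (fst p) (fst (snd p)) (snd (snd p)))"
  shows "computable A (\<lambda>x. case l x of [] \<Rightarrow> a x | y # ys \<Rightarrow> g x y ys)"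
proof -
  have "computable A (\<lambda>x. case enc (l x) of 0 \<Rightarrow> 0 | Suc _ \<Rightarrow> (1::nat))"
    by (intro comp_intros assms)
  then obtain rs where rs: "\<And>x. eval A rs [enc x] (case enc (l x) of 0 \<Rightarrow> 0 | Suc _ \<Rightarrow> 1)"
    unfolding computable_def enc_nat_def by blast
  have "computable A (\<lambda>x. enc (l x) - 1)" by (intro comp_intros assms)
  then obtain rl where rl: "\<And>x. eval A rl [enc x] (enc (l x) - 1)"
    unfolding computable_def enc_nat_def by blast
  obtain ra where ra: "\<And>x. eval A ra [enc x] (enc (a x))"
    using assms(2) unfolding computable_def by blast
  obtain rg where rg: "\<And>p. eval A rg [enc p] (enc (g (fst p) (fst (snd p)) (snd (snd p))))"
    using assms(3) unfolding computable_def by blast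
  note r = ra rg
  let ?g = "Comp rg [Comp pair_prog [Proj 2, Comp rl [Proj 2]]]"
  have "eval A (Comp (Prim ra ?g) [rs, Proj 0]) [enc x]
      (enc (case l x of [] \<Rightarrow> a x | y # ys \<Rightarrow> g x y ys))" for x
  proof (rule eval_Comp2[OF rs eval_Proj])
    show "eval A (Prim ra ?g) [case enc (l x) of 0 \<Rightarrow> 0 | Suc _ \<Rightarrow> 1, enc x]
        (enc (case l x of [] \<Rightarrow> a x | y # ys \<Rightarrow> g x y ys))"
    proof (cases "l x")
      case Nil
      then show ?thesis by (simp add: eval.prim0 r)
    next
      case (Cons y ys)
      have "eval A (Comp pair_prog [Proj 2, Comp rl [Proj 2]]) [enc (a x), 0, enc x] (enc (x, y, ys))"
        unfolding enc_prod_def[of "(x, y, ys)"] fst_conv snd_conv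
        using rl[of x] Cons
        by (intro eval_Comp2[OF _ eval_Comp1[of _ _ _ "enc x"] eval_pair_prog])
          (auto intro!: eval_Proj simp: enc_Cons)
      from eval_Comp1[OF this] have "eval A ?g [enc (a x), 0, enc x] (enc (g x y ys))"
        using r(2)[of "(x, y, ys)"] by simp
      then have "eval A (Prim ra ?g) [Suc 0, enc x] (enc (g x y ys))"
        by (intro eval.primS[OF eval.prim0]) (auto simp: r)
      then show ?thesis by (simp add: Cons enc_Cons)
    qed
  qed auto
  then show ?thesis by (rule computableI)
qed

lemma computable_foldl [comp_intros]:
  assumes "computable A a" "computable A l"
    "computable A (\<lambda>p. g (fst p) (fst (snd p)) (snd (snd p)))"
  shows "computable A (\<lambda>x. foldl (g x) (a x) (l x))"
proof -
  \<comment> \<open>The state consists of the accumulator and the unread part of the list. Steps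
    after the end of the list change nothing, so any bound on its length will do as number of
    steps.\<close>
  define h where "h x p = (case snd p of [] \<Rightarrow> p | y # ys \<Rightarrow> (g x (fst p) y, ys))" for x p
  have "computable A (\<lambda>x. fst (rec_nat (a x, l x) (\<lambda>_. h x) (enc (l x))))"
    unfolding h_def
    by (intro comp_intros assms
      computable_compose[OF assms(3), of "\<lambda>p. (fst (fst p), fst (snd (snd (fst p))), fst (snd p))", simplified])
  moreover have "rec_nat (b, xs) (\<lambda>_. h x) n = (foldl (g x) b (take n xs), drop n xs)" for x b n xs
  proof (induction n)
    case (Suc n)
    then show ?case
      by (cases "n < length xs")
        (auto simp: h_def take_Suc_conv_app_nth Cons_nth_drop_Suc[symmetric] split: list.split)
  qed simp
  ultimately show ?thesis by (simp add: length_le_enc)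
qed

lemma computable_rev [comp_intros]:
  assumes "computable A l" shows "computable A (\<lambda>x. rev (l x))"
proof -
  have "computable A (\<lambda>x. foldl (\<lambda>ys y. y # ys) [] (l x))" by (intro comp_intros assms)
  moreover have "foldl (\<lambda>ys y. y # ys) zs ys = rev ys @ zs" for ys zs :: "'b list"
    by (induction ys arbitrary: zs) auto
  ultimately show ?thesis by simp
qed

lemma computable_foldr [comp_intros]:
  assumes "computable A l" "computable A a"
    "computable A (\<lambda>p. g (fst p) (fst (snd p)) (snd (snd p)))"
  shows "computable A (\<lambda>x. foldr (g x) (l x) (a x))"
  unfolding foldr_conv_foldl
  by (intro comp_intros assms computable_compose[OF assms(3), of "\<lambda>p. (fst p, snd (snd p), fst (snd p))", simplified])

lemma foldr_Cons_eq_map: "foldr (\<lambda>y ys. h y # ys) zs [] = map h zs"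
  by (induction zs) auto

lemma foldr_If_eq_filter: "foldr (\<lambda>y ys. if Q y then y # ys else ys) zs [] = filter Q zs"
  by (induction zs) auto

lemma foldr_Cons_eq_append: "foldr (#) xs ys = xs @ ys"
  by (induction xs) auto

lemma computable_map [comp_intros]:
  assumes "computable A l" "computable A (\<lambda>p. g (fst p) (snd p))"
  shows "computable A (\<lambda>x. map (g x) (l x))"
proof -
  have "computable A (\<lambda>x. foldr (\<lambda>y ys. g x y # ys) (l x) [])"
    by (intro comp_intros assms computable_compose[OF assms(2), of "\<lambda>p. (fst p, fst (snd p))", simplified])
  then show ?thesis by (simp add: foldr_Cons_eq_map)
qed

lemma computable_filter [comp_intros]:
  assumes "computable A l" "computable A (\<lambda>p. P (fst p) (snd p))"
  shows "computable A (\<lambda>x. filter (P x) (l x))"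
proof -
  have "computable A (\<lambda>x. foldr (\<lambda>y ys. if P x y then y # ys else ys) (l x) [])"
    by (intro comp_intros assms computable_compose[OF assms(2), of "\<lambda>p. (fst p, fst (snd p))", simplified])
  then show ?thesis by (simp add: foldr_If_eq_filter)
qed

lemma computable_append [comp_intros]:
  assumes "computable A f" "computable A g" shows "computable A (\<lambda>x. f x @ g x)"
proof -
  have "computable A (\<lambda>x. foldr (#) (f x) (g x))" by (intro comp_intros assms)
  then show ?thesis by (simp add: foldr_Cons_eq_append)
qed

lemma computable_length [comp_intros]:
  assumes "computable A l" shows "computable A (\<lambda>x. length (l x))"
proof -
  have "computable A (\<lambda>x. foldl (\<lambda>n _. Suc n) 0 (l x))" by (intro comp_intros assms)
  moreover have "foldl (\<lambda>n _. Suc n) k ys = length ys + k" for ys :: "'b list" and k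
    by (induction ys arbitrary: k) auto
  ultimately show ?thesis by simp
qed

lemma computable_Ball_set [comp_intros]:
  assumes "computable A l" "computable A (\<lambda>p. P (fst p) (snd p))"
  shows "computable A (\<lambda>x. \<forall>y\<in>set (l x). P x y)"
proof -
  have "computable A (\<lambda>x. filter (\<lambda>y. \<not> P x y) (l x) = [])" by (intro comp_intros assms)
  then show ?thesis by (simp add: filter_empty_conv)
qed

lemma computable_Bex_set [comp_intros]:
  assumes "computable A l" "computable A (\<lambda>p. P (fst p) (snd p))"
  shows "computable A (\<lambda>x. \<exists>y\<in>set (l x). P x y)"
proof -
  have "computable A (\<lambda>x. \<not> (\<forall>y\<in>set (l x). \<not> P x y))" by (intro comp_intros assms)
  then show ?thesis by simp
qed

lemma computable_in_set [comp_intros]: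
  assumes "computable A f" "computable A l" shows "computable A (\<lambda>x. f x \<in> set (l x))"
proof -
  have "computable A (\<lambda>x. \<exists>y\<in>set (l x). y = f x)" by (intro comp_intros assms computable_compose[OF assms(1)])
  then show ?thesis by simp
qed

lemma computable_hd [comp_intros]:
  assumes "computable A l" shows "computable A (\<lambda>x. hd (l x))"
  unfolding hd_def by (intro comp_intros assms)

lemma computable_drop [comp_intros]:
  assumes "computable A n" "computable A l" shows "computable A (\<lambda>x. drop (n x) (l x))"
proof -
  have "computable A (\<lambda>x. rec_nat (l x) (\<lambda>_ ys. case ys of [] \<Rightarrow> [] | y # zs \<Rightarrow> zs) (n x))"
    by (intro comp_intros assms)
  moreover have "rec_nat ys (\<lambda>_ ys. case ys of [] \<Rightarrow> [] | y # zs \<Rightarrow> zs) k = drop k ys"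
    for ys :: "'b list" and k
    by (induction k) (auto simp: drop_Suc tl_drop split: list.split, metis list.sel(2,3) drop_Suc tl_drop)
  ultimately show ?thesis by simp
qed

lemma computable_take [comp_intros]:
  assumes "computable A n" "computable A l" shows "computable A (\<lambda>x. take (n x) (l x))"
proof -
  have "computable A (\<lambda>x. rev (drop (length (l x) - n x) (rev (l x))))"
    by (intro comp_intros assms)
  moreover have "rev (drop (length ys - k) (rev ys)) = take k ys" for ys :: "'b list" and k
    by (cases "k \<le> length ys") (auto simp: rev_drop)
  ultimately show ?thesis by simp
qed

section \<open>A universal machine\<close>

inductive_cases eval_ZerE: "eval A Zer xs y"
inductive_cases eval_SucE: "eval A Suc_f xs y"
inductive_cases eval_ProjE: "eval A (Proj i) xs y"
inductive_cases eval_OracE: "eval A Orac xs y"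
inductive_cases eval_CompE: "eval A (Comp f gs) xs y"
inductive_cases eval_PrimE: "eval A (Prim f g) xs y"
inductive_cases eval_MuE: "eval A (Mu f) xs y"

lemma eval_deterministic: "eval A f xs y \<Longrightarrow> eval A f xs z \<Longrightarrow> y = z"
proof (induction arbitrary: z rule: eval.induct)
  case (comp xs gs ys f y)
  from comp.prems obtain zs where zs: "list_all2 (\<lambda>g. eval A g xs) gs zs" "eval A f zs z"
    by (rule eval_CompE)
  have "ys = zs"
    using comp.IH(1) zs(1) by (auto simp: list_all2_conv_all_nth intro!: nth_equalityI)
  then show ?case using comp.IH(2) zs(2) by blast
next
  case (prim0 f xs z g z')
  from prim0.prems have "eval A f xs z'" by (rule eval_PrimE) auto
  then show ?case by (rule prim0.IH)
next
  case (primS f g n xs y z z')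
  from primS.prems obtain y' where y': "eval A (Prim f g) (n # xs) y'" "eval A g (y' # n # xs) z'"
    by (rule eval_PrimE) auto
  with primS.IH(1) have "y = y'" by blast
  then show ?case using primS.IH(2) y'(2) by blast
next
  case (mu f n xs)
  from mu.prems have z: "eval A f (z # xs) 0" "\<forall>m<z. \<exists>y>0. eval A f (m # xs) y"
    by (rule eval_MuE; simp)+
  show ?case
  proof (rule linorder_cases[of n z])
    assume "n < z"
    then obtain y where "y > 0" "eval A f (n # xs) y" using z(2) by blast
    then show ?thesis using mu.IH(1) by blast
  next
    assume "z < n"
    then obtain y where "y > 0" "\<And>w. eval A f (z # xs) w \<Longrightarrow> y = w" using mu.IH(2) by blast
    then show ?thesis using z(1) by blast
  qed
qed (auto elim: eval_ZerE eval_SucE eval_ProjE eval_OracE)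

section \<open>Changing the oracle\<close>

fun subst_oracle :: "recf \<Rightarrow> recf \<Rightarrow> recf" where
  "subst_oracle q Orac = Comp q [Proj 0]"
| "subst_oracle q (Comp f gs) = Comp (subst_oracle q f) (map (subst_oracle q) gs)"
| "subst_oracle q (Prim f g) = Prim (subst_oracle q f) (subst_oracle q g)"
| "subst_oracle q (Mu f) = Mu (subst_oracle q f)"
| "subst_oracle q f = f"

lemma eval_subst_oracle:
  assumes q: "\<And>n. eval B q [n] (if A n then 1 else 0)"
  shows "eval A f xs y \<Longrightarrow> eval B (subst_oracle q f) xs y"
proof (induction rule: eval.induct)
  case (orac x xs)
  \<comment> \<open>\<open>Orac\<close> looks only at its first argument, which
    \<open>Proj 0\<close> passes on to \<open>q\<close>.\<close>
  show ?case by (simp only: subst_oracle.simps, rule eval_Comp1[OF eval_Proj q]) auto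
next
  case (comp xs gs ys f z)
  then show ?case
    by (auto intro!: eval.comp[of _ _ _ ys] simp: list_all2_conv_all_nth)
qed (auto intro: eval.intros)

lemma computable_iff_turing_red: "computable X Y \<longleftrightarrow> turing_red Y X"
  by (simp add: computable_def turing_red_def enc_bool_def)

lemma computable_change_oracle:
  assumes "computable B A" "computable A f" shows "computable B f"
proof -
  obtain q where q: "\<And>n. eval B q [n] (if A n then 1 else 0)"
    using assms(1) by (auto simp: computable_iff_turing_red turing_red_def)
  obtain r where "\<And>x. eval A r [enc x] (enc (f x))"
    using assms(2) unfolding computable_def by blast
  then show ?thesis
    by (intro computableI[of _ "subst_oracle q r"] eval_subst_oracle[OF q])
qed

lemma computable_prod_decode [comp_intros]:
  "computable A f \<Longrightarrow> computable A (\<lambda>x. prod_decode (f x))"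
  by (rule computable_compose, rule computableI[of _ "Proj 0"])
    (auto simp: enc_prod_def intro!: eval_Proj)

lemma computable_prod_encode [comp_intros]:
  "computable A f \<Longrightarrow> computable A (\<lambda>x. prod_encode (f x))"
  by (rule computable_compose, rule computableI[of _ "Proj 0"])
    (auto simp: enc_prod_def intro!: eval_Proj)

lemma surj_enc_nat: "surj (enc :: nat \<Rightarrow> nat)"
  by (simp add: surj_def)

lemma surj_enc_prod:
  assumes "surj (enc :: 'a::code \<Rightarrow> nat)" "surj (enc :: 'b::code \<Rightarrow> nat)"
  shows "surj (enc :: 'a \<times> 'b \<Rightarrow> nat)"
proof (rule surjI[where f="\<lambda>n. (inv enc (fst (prod_decode n)), inv enc (snd (prod_decode n)))"])
  show "enc (inv enc (fst (prod_decode n)) :: 'a, inv enc (snd (prod_decode n)) :: 'b) = n" for n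
    by (simp add: enc_prod_def surj_f_inv_f assms)
qed

lemma surj_enc_list:
  assumes "surj (enc :: 'a::code \<Rightarrow> nat)" shows "surj (enc :: 'a list \<Rightarrow> nat)"
proof (rule surjI[where f="\<lambda>n. map (inv enc) (list_decode n)"])
  show "enc (map (inv enc) (list_decode n) :: 'a list) = n" for n
    by (simp add: enc_list_def surj_f_inv_f assms comp_def)
qed

text \<open>If every number is a code, decoding leaves the underlying number unchanged. This gives
  searches through all derivations by searching through numbers.\<close>

lemma computable_inv_enc:
  assumes "surj (enc :: 'b::code \<Rightarrow> nat)" "computable A f"
  shows "computable A (\<lambda>x. inv enc (f x) :: 'b)"
proof (rule computable_compose[OF _ assms(2)], rule computableI[of _ "Proj 0"])
  show "eval A (Proj 0) [enc n] (enc (inv enc n :: 'b))" for n :: nat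
    by (auto simp: surj_f_inv_f[OF assms(1)] intro: eval_Proj)
qed

section \<open>Codes of programs and formal derivations\<close>

fun recf_code :: "recf \<Rightarrow> nat" where
  "recf_code Zer = prod_encode (0, 0)"
| "recf_code Suc_f = prod_encode (1, 0)"
| "recf_code (Proj i) = prod_encode (2, i)"
| "recf_code Orac = prod_encode (3, 0)"
| "recf_code (Comp f gs) = prod_encode (4, prod_encode (recf_code f, enc (map recf_code gs)))"
| "recf_code (Prim f g) = prod_encode (5, prod_encode (recf_code f, recf_code g))"
| "recf_code (Mu f) = prod_encode (6, recf_code f)"

type_synonym fact = "nat \<times> nat list \<times> nat"

text \<open>A fact \<open>(p, xs, y)\<close> asserts that the program with code \<open>p\<close> maps \<open>xs\<close> to \<open>y\<close>;
  it is justified by \<open>D\<close> if it follows from facts in \<open>D\<close> by one rule of \<^const>\<open>eval\<close>.\<close>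

definition justified :: "(nat \<Rightarrow> bool) \<Rightarrow> fact list \<Rightarrow> fact \<Rightarrow> bool" where
  "justified A D t \<longleftrightarrow> (case t of (p, xs, y) \<Rightarrow> case prod_decode p of (c, b) \<Rightarrow>
     c = 0 \<and> y = 0
   \<or> c = 1 \<and> xs \<noteq> [] \<and> y = Suc (hd xs)
   \<or> c = 2 \<and> take 1 (drop b xs) = [y]
   \<or> c = 3 \<and> xs \<noteq> [] \<and> y = (if A (hd xs) then 1 else 0)
   \<or> c = 4 \<and> (case prod_decode b of (f, l) \<Rightarrow> case inv enc l of gs \<Rightarrow>
       \<exists>t\<in>set D. case t of (f', ys, y') \<Rightarrow> f' = f \<and> y' = y \<and> length ys = length gs \<and>
         (\<forall>j<length gs. (hd (drop j gs), xs, hd (drop j ys)) \<in> set D))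
   \<or> c = 5 \<and> xs \<noteq> [] \<and> (case prod_decode b of (f, g) \<Rightarrow>
       case hd xs of 0 \<Rightarrow> (f, drop 1 xs, y) \<in> set D
       | Suc n \<Rightarrow> \<exists>t\<in>set D. case t of (p', xs', z) \<Rightarrow> p' = p \<and> xs' = n # drop 1 xs \<and>
           (g, z # n # drop 1 xs, y) \<in> set D)
   \<or> c = 6 \<and> (b, y # xs, 0) \<in> set D \<and>
       (\<forall>m<y. \<exists>t\<in>set D. case t of (b', xs', z) \<Rightarrow> b' = b \<and> xs' = m # xs \<and> 0 < z))"

lemma computable_justified [comp_intros]:
  assumes "computable A f" "computable A g"
  shows "computable A (\<lambda>x. justified A (f x) (g x))"
proof -
  have "computable A (\<lambda>q. justified A (fst q) (snd q))"
    unfolding justified_def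
    by (intro comp_intros computable_inv_enc surj_enc_list surj_enc_nat)
  from computable_compose[OF this computable_Pair[OF assms]] show ?thesis by simp
qed

text \<open>A formal derivation with the most recent fact in front: each entry is justified by the
  entries behind it.\<close>

primrec valid :: "(nat \<Rightarrow> bool) \<Rightarrow> fact list \<Rightarrow> bool" where
  "valid A [] \<longleftrightarrow> True"
| "valid A (t # D) \<longleftrightarrow> valid A D \<and> justified A D t"

text \<open>A bounded quantifier over positions puts \<open>valid\<close> into the reach of the
  closure rules.\<close>

lemma valid_iff: "valid A D \<longleftrightarrow> (\<forall>i<length D. justified A (drop (Suc i) D) (hd (drop i D)))"
  by (induction D) (auto simp: All_less_Suc2)

lemma computable_valid [comp_intros]:
  assumes "computable A f" shows "computable A (\<lambda>x. valid A (f x))"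
proof -
  have "computable A (\<lambda>D. valid A D)" unfolding valid_iff by (intro comp_intros)
  from computable_compose[OF this assms] show ?thesis .
qed

text \<open>Membership in \<open>D\<close> occurs only positively, and only the tags 4, 5 and 6
  consult \<open>D\<close> at all.\<close>

lemma justified_mono:
  assumes "justified A D t" "set D \<subseteq> set D'" shows "justified A D' t"
proof -
  obtain p xs y where t: "t = (p, xs, y)" by (cases t)
  obtain c b where p: "prod_decode p = (c, b)" by (cases "prod_decode p")
  obtain f l where b: "prod_decode b = (f, l)" by (cases "prod_decode b")
  consider "c = 4" | "c = 5" | "c = 6" | "c \<noteq> 4" "c \<noteq> 5" "c \<noteq> 6" by blast
  then show ?thesis
  proof cases
    case 1
    with assms show ?thesis unfolding justified_def t by (simp add: p b) blast
  next
    case 2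
    with assms show ?thesis unfolding justified_def t by (cases "hd xs") (simp_all add: p b, blast+)
  next
    case 3
    with assms show ?thesis unfolding justified_def t by (simp add: p b) blast
  next
    case 4
    with assms(1) show ?thesis unfolding justified_def t by (simp add: p b)
  qed
qed

lemma valid_append: "valid A D \<Longrightarrow> valid A D' \<Longrightarrow> valid A (D @ D')"
  by (induction D) (auto intro: justified_mono)

lemma inv_enc_enc: "inv enc (enc (xs :: nat list)) = xs"
  by (simp add: inj_enc)

text \<open>Induction along the derivation. Decoding \<open>recf_code f\<close> yields codes of
  subprograms of \<open>f\<close> (or of \<open>f\<close> itself, for \<open>Prim\<close>), so the
  facts that justify the newest one again concern genuine programs and the induction hypothesis
  applies to them.\<close>

lemma valid_sound:
  "valid A D \<Longrightarrow> (recf_code f, xs, y) \<in> set D \<Longrightarrow> eval A f xs y"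
proof (induction D arbitrary: f xs y)
  case (Cons t D)
  show ?case
  proof (cases "(recf_code f, xs, y) \<in> set D")
    case True
    then show ?thesis using Cons by auto
  next
    case False
    then have j: "justified A D (recf_code f, xs, y)" using Cons.prems by auto
    have IH: "(recf_code f, xs, y) \<in> set D \<Longrightarrow> eval A f xs y" for f xs y
      using Cons by auto
    show ?thesis
    proof (cases f)
      case Zer then show ?thesis using j by (auto simp: justified_def intro: eval.zer)
    next
      case Suc_f then show ?thesis using j
        by (cases xs) (auto simp: justified_def intro: eval.suc)
    next
      case (Proj i)
      then have y: "take 1 (drop i xs) = [y]" using j by (auto simp: justified_def)
      then have "i < length xs" by (cases "i < length xs") auto
      with y show ?thesis unfolding Proj by (intro eval_Proj) (auto simp: take_Suc hd_drop_conv_nth)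
    next
      case Orac
      then obtain x zs where "xs = x # zs" "y = (if A x then 1 else 0)"
        using j by (cases xs) (auto simp: justified_def)
      then show ?thesis using eval.orac[of A x zs] Orac by simp
    next
      case (Comp h gs)
      then obtain ys where ys: "(recf_code h, ys, y) \<in> set D" "length ys = length gs"
        "\<forall>j<length gs. (hd (drop j (map recf_code gs)), xs, hd (drop j ys)) \<in> set D"
        using j by (auto simp: justified_def inv_enc_enc)
      have "list_all2 (\<lambda>g y. eval A g xs y) gs ys"
        using ys(2,3) by (auto simp: list_all2_conv_all_nth hd_drop_conv_nth intro!: IH)
      then show ?thesis unfolding Comp using IH[OF ys(1)] by (rule eval.comp)
    next
      case (Prim h g)
      then obtain n zs where xs: "xs = n # zs" using j by (cases xs) (auto simp: justified_def)
      show ?thesis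
      proof (cases n)
        case 0
        then have "(recf_code h, zs, y) \<in> set D" using j Prim xs by (auto simp: justified_def)
        then show ?thesis unfolding Prim xs 0 by (intro eval.prim0 IH)
      next
        case (Suc m)
        then obtain z where "(recf_code (Prim h g), m # zs, z) \<in> set D" "(recf_code g, z # m # zs, y) \<in> set D"
          using j Prim xs by (auto simp: justified_def)
        then show ?thesis unfolding Prim xs Suc by (intro eval.primS IH)
      qed
    next
      case (Mu h)
      then have "(recf_code h, y # xs, 0) \<in> set D"
        "\<forall>m<y. \<exists>z>0. (recf_code h, m # xs, z) \<in> set D"
        using j by (auto simp: justified_def)
      then show ?thesis unfolding Mu using IH by (meson eval.mu)
    qed
  qed
qed simp

lemma valid_collect:
  assumes "finite F" "\<And>t. t \<in> F \<Longrightarrow> \<exists>D. valid A D \<and> t \<in> set D"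
  shows "\<exists>D. valid A D \<and> F \<subseteq> set D"
  using assms
proof (induction F rule: finite_induct)
  case empty
  show ?case by (rule exI[of _ "[]"]) simp
next
  case (insert t F)
  then obtain D D' where "valid A D" "F \<subseteq> set D" "valid A D'" "t \<in> set D'" by (meson insert_iff)
  then show ?case by (intro exI[of _ "D @ D'"]) (auto intro: valid_append)
qed

text \<open>Each rule of \<open>eval\<close> has a finite set \<open>F\<close> of premises. Their
  derivations are concatenated into one, and the conclusion \<open>t\<close> is put in
  front.\<close>

lemma valid_step:
  assumes "finite F" "\<And>t. t \<in> F \<Longrightarrow> \<exists>D. valid A D \<and> t \<in> set D"
    "\<And>D. F \<subseteq> set D \<Longrightarrow> justified A D t"
  shows "\<exists>D. valid A D \<and> t \<in> set D"
proof -
  obtain D where "valid A D" "F \<subseteq> set D" using valid_collect[OF assms(1,2)] by blast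
  then show ?thesis by (intro exI[of _ "t # D"]) (simp add: assms(3))
qed

lemma valid_complete: "eval A f xs y \<Longrightarrow> \<exists>D. valid A D \<and> (recf_code f, xs, y) \<in> set D"
proof (induction rule: eval.induct)
  case (zer xs)
  show ?case by (rule valid_step[of "{}"]) (auto simp: justified_def)
next
  case (suc x xs)
  show ?case by (rule valid_step[of "{}"]) (auto simp: justified_def)
next
  case (proj i xs)
  then have "take 1 (drop i xs) = [xs ! i]" by (simp add: Cons_nth_drop_Suc[symmetric])
  then have "justified A D (recf_code (Proj i), xs, xs ! i)" for D by (simp add: justified_def)
  then show ?case by (rule valid_step[of "{}", rotated 2]) auto
next
  case (orac x xs)
  show ?case by (rule valid_step[of "{}"]) (auto simp: justified_def)
next
  case (comp xs gs ys f z)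
  let ?F = "insert (recf_code f, ys, z) ((\<lambda>j. (recf_code (gs ! j), xs, ys ! j)) ` {..<length gs})"
  have gs: "length gs = length ys"
    "\<And>j. j < length gs \<Longrightarrow> \<exists>D. valid A D \<and> (recf_code (gs ! j), xs, ys ! j) \<in> set D"
    using comp.IH(1) by (simp_all add: list_all2_conv_all_nth)
  show ?case
  proof (rule valid_step[of ?F])
    show "\<exists>D. valid A D \<and> t \<in> set D" if "t \<in> ?F" for t
      using that gs(2) comp.IH(2) by blast
    show "justified A D (recf_code (Comp f gs), xs, z)" if F: "?F \<subseteq> set D" for D
    proof -
      have "(recf_code f, ys, z) \<in> set D"
        "\<forall>j<length gs. (hd (drop j (map recf_code gs)), xs, hd (drop j ys)) \<in> set D"
        using F gs(1) by (auto simp: hd_drop_conv_nth)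
      then show ?thesis using gs(1) by (simp add: justified_def inv_enc_enc) blast
    qed
  qed simp
next
  case (prim0 f xs z g)
  show ?case
  proof (rule valid_step[of "{(recf_code f, xs, z)}"])
    show "\<exists>D. valid A D \<and> t \<in> set D" if "t \<in> {(recf_code f, xs, z)}" for t
      using that prim0.IH by blast
    show "justified A D (recf_code (Prim f g), 0 # xs, z)" if "{(recf_code f, xs, z)} \<subseteq> set D" for D
      using that by (simp add: justified_def)
  qed simp
next
  case (primS f g n xs y z)
  let ?F = "{(recf_code (Prim f g), n # xs, y), (recf_code g, y # n # xs, z)}"
  show ?case
  proof (rule valid_step[of ?F])
    show "\<exists>D. valid A D \<and> t \<in> set D" if "t \<in> ?F" for t
      using that primS.IH by blast
    show "justified A D (recf_code (Prim f g), Suc n # xs, z)" if "?F \<subseteq> set D" for D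
    proof -
      have "\<exists>t\<in>set D. case t of (p', xs', y) \<Rightarrow> p' = recf_code (Prim f g) \<and> xs' = n # xs \<and>
          (recf_code g, y # n # xs, z) \<in> set D"
        using that by (intro bexI[of _ "(recf_code (Prim f g), n # xs, y)"]) auto
      then show ?thesis by (simp add: justified_def)
    qed
  qed simp
next
  case (mu f n xs)
  then have "\<forall>m. \<exists>y. m < n \<longrightarrow> 0 < y \<and> (\<exists>D. valid A D \<and> (recf_code f, m # xs, y) \<in> set D)" by blast
  then obtain h where h: "\<And>m. m < n \<Longrightarrow> 0 < h m"
    "\<And>m. m < n \<Longrightarrow> \<exists>D. valid A D \<and> (recf_code f, m # xs, h m) \<in> set D"
    unfolding choice_iff by blast
  let ?F = "insert (recf_code f, n # xs, 0) ((\<lambda>m. (recf_code f, m # xs, h m)) ` {..<n})"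
  show ?case
  proof (rule valid_step[of ?F])
    show "\<exists>D. valid A D \<and> t \<in> set D" if "t \<in> ?F" for t
      using that mu.IH(1) h(2) by blast
    show "justified A D (recf_code (Mu f), xs, n)" if F: "?F \<subseteq> set D" for D
    proof -
      have "(recf_code f, n # xs, 0) \<in> set D" using F by simp
      moreover have "\<exists>t\<in>set D. case t of (b', xs', z) \<Rightarrow> b' = recf_code f \<and> xs' = m # xs \<and> 0 < z"
        if "m < n" for m
        using F h(1)[OF that] that by (intro bexI[of _ "(recf_code f, m # xs, h m)"]) auto
      ultimately show ?thesis by (simp add: justified_def)
    qed
  qed simp
qed

text \<open>The stage bounds the code of a derivation, which makes acceptance by stage
  \<open>s\<close> decidable in \<open>A\<close>. Output 1 is required so that a program for a
  characteristic function accepts exactly the members.\<close>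

definition accepts :: "(nat \<Rightarrow> bool) \<Rightarrow> nat \<Rightarrow> nat \<Rightarrow> nat \<Rightarrow> bool" where
  "accepts A s e x \<longleftrightarrow> (\<exists>d\<le>s. case inv enc d of D \<Rightarrow> valid A D \<and> (e, [x], 1) \<in> set D)"

lemma accepts_mono: "accepts A s e x \<Longrightarrow> s \<le> t \<Longrightarrow> accepts A t e x"
  unfolding accepts_def by (elim exE) (auto intro: order_trans)

lemma accepts_iff_eval: "(\<exists>s. accepts A s (recf_code f) x) \<longleftrightarrow> eval A f [x] 1"
proof
  show "eval A f [x] 1" if "\<exists>s. accepts A s (recf_code f) x"
    using that valid_sound unfolding accepts_def by blast
  show "\<exists>s. accepts A s (recf_code f) x" if "eval A f [x] 1"
  proof -
    from valid_complete[OF that] obtain D where "valid A D" "(recf_code f, [x], 1) \<in> set D" by blast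
    then have "accepts A (enc D) (recf_code f) x"
      unfolding accepts_def by (intro exI[of _ "enc D"]) (simp add: inj_enc)
    then show ?thesis ..
  qed
qed

lemma computable_accepts [comp_intros]:
  assumes "computable A f" "computable A g" "computable A h"
  shows "computable A (\<lambda>x. accepts A (f x) (g x) (h x))"
proof -
  have "computable A (\<lambda>q. accepts A (fst q) (fst (snd q)) (snd (snd q)))"
    unfolding accepts_def
    by (intro comp_intros computable_inv_enc surj_enc_list surj_enc_prod surj_enc_nat)
  from computable_compose[OF this computable_Pair[OF assms(1) computable_Pair[OF assms(2,3)]]]
  show ?thesis by simp
qed

section \<open>Computing with binary strings and joins\<close>

lemma computable_half [comp_intros]:
  assumes "computable A f" shows "computable A (\<lambda>x. f x div 2 :: nat)"
proof -
  have "computable A (\<lambda>x. LEAST m. f x \<le> 2 * m + 1)"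
    by (intro comp_intros assms computable_compose[OF assms, of "\<lambda>p. fst p"]) presburger
  moreover have "(LEAST m. n \<le> 2 * m + 1) = n div 2" for n :: nat
    by (rule Least_equality) auto
  ultimately show ?thesis by simp
qed

lemma computable_even [comp_intros]:
  assumes "computable A f" shows "computable A (\<lambda>x. even (f x :: nat))"
proof -
  have "computable A (\<lambda>x. 2 * (f x div 2) = f x)" by (intro comp_intros assms)
  moreover have "2 * (n div 2) = n \<longleftrightarrow> even n" for n :: nat by presburger
  ultimately show ?thesis by simp
qed

lemma computable_bl_code [comp_intros]:
  assumes "computable A f" shows "computable A (\<lambda>x. bl_code (f x))"
proof -
  have "computable A (\<lambda>x. foldr (\<lambda>b c. 2 * c + (if b then 2 else 1)) (f x) (0::nat))"
    by (intro comp_intros assms)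
  moreover have "foldr (\<lambda>b c. 2 * c + (if b then 2 else 1)) bs 0 = bl_code bs" for bs
    by (induction bs) auto
  ultimately show ?thesis by simp
qed

text \<open>\<open>bl_code\<close> is bijective base 2 notation with the head as lowest digit: an
  even positive code has head \<open>True\<close>, an odd one \<open>False\<close>. Bits are
  collected in reverse, and \<open>k\<close> rounds suffice because the length is at most the
  code.\<close>

definition bl_decode :: "nat \<Rightarrow> bool list" where
  "bl_decode k = rev (snd (rec_nat (k, [])
     (\<lambda>_ q. if fst q = 0 then q else ((fst q - 1) div 2, even (fst q) # snd q)) k))"

lemma length_le_bl_code: "length bs \<le> bl_code bs"
  by (induction bs) auto

lemma bl_decode_bl_code [simp]: "bl_decode (bl_code bs) = bs"
proof -
  have "rec_nat (bl_code bs, []) (\<lambda>_ q. if fst q = 0 then q else ((fst q - 1) div 2, even (fst q) # snd q)) n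
      = (bl_code (drop n bs), rev (take n bs))" for n
  proof (induction n)
    case (Suc n)
    show ?case
    proof (cases "n < length bs")
      case True
      then have "drop n bs = bs ! n # drop (Suc n) bs" by (simp add: Cons_nth_drop_Suc)
      with True Suc show ?thesis by (simp add: take_Suc_conv_app_nth)
    qed (use Suc in simp)
  qed simp
  then show ?thesis by (simp add: bl_decode_def length_le_bl_code)
qed

lemma computable_bl_decode [comp_intros]:
  assumes "computable A f" shows "computable A (\<lambda>x. bl_decode (f x))"
proof -
  have "computable A bl_decode" unfolding bl_decode_def by (intro comp_intros)
  from computable_compose[OF this assms] show ?thesis .
qed

lemma computable_pref [comp_intros]:
  assumes "computable A X" "computable A n" shows "computable A (\<lambda>x. pref X (n x))"
proof -
  have "computable A (\<lambda>x. rec_nat [] (\<lambda>i ys. ys @ [X i]) (n x))"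
    by (intro comp_intros assms computable_compose[OF assms(1)])
  moreover have "rec_nat [] (\<lambda>i ys. ys @ [X i]) k = pref X k" for k
    by (induction k) (auto simp: pref_def)
  ultimately show ?thesis by simp
qed

lemma computable_join_left: "computable (join X Y) X"
proof -
  have "computable (join X Y) (\<lambda>n. join X Y (2 * n))" by (intro comp_intros)
  then show ?thesis by (simp add: join_def)
qed

lemma computable_join_right: "computable (join X Y) Y"
proof -
  have "computable (join X Y) (\<lambda>n. join X Y (2 * n + 1))" by (intro comp_intros)
  then show ?thesis by (simp add: join_def)
qed

section \<open>The construction\<close>

primrec strings :: "nat \<Rightarrow> bool list list" where
  "strings 0 = [[]]"
| "strings (Suc n) = map ((#) True) (strings n) @ map ((#) False) (strings n)"

lemma set_strings: "set (strings n) = {\<sigma>. length \<sigma> = n}"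
proof (induction n)
  case (Suc n)
  have "\<sigma> \<in> set (strings (Suc n)) \<longleftrightarrow> length \<sigma> = Suc n" for \<sigma>
    by (cases \<sigma>) (auto simp: Suc image_iff)
  then show ?case by blast
qed auto

lemma distinct_strings: "distinct (strings n)"
  by (induction n) (auto simp: distinct_map)

lemma length_filter_strings: "length (filter P (strings n)) = card {\<sigma>. length \<sigma> = n \<and> P \<sigma>}"
proof -
  have "length (filter P (strings n)) = card (set (filter P (strings n)))"
    by (rule distinct_card[symmetric]) (simp add: distinct_strings)
  also have "set (filter P (strings n)) = {\<sigma>. length \<sigma> = n \<and> P \<sigma>}" by (auto simp: set_strings)
  finally show ?thesis .
qed

lemma computable_strings [comp_intros]:
  assumes "computable A f" shows "computable A (\<lambda>x. strings (f x))"
proof -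
  have "computable A strings" unfolding strings_def by (intro comp_intros)
  from computable_compose[OF this assms] show ?thesis .
qed

lemma finite_strings: "finite {\<sigma> :: bool list. length \<sigma> = n \<and> P \<sigma>}"
  by (rule finite_subset[OF _ finite_set[of "strings n"]]) (auto simp: set_strings)

lemma card_strings: "card {\<sigma> :: bool list. length \<sigma> = n} = 2 ^ n"
proof -
  have "length (strings n) = 2 ^ n" by (induction n) auto
  then show ?thesis using length_filter_strings[of "\<lambda>_. True" n] by simp
qed

text \<open>Cutting at position \<open>t\<close> leaves a string satisfying \<open>P\<close> and
  \<open>s - t\<close> free bits.\<close>

lemma card_extensions:
  assumes "t \<le> s"
  shows "card {\<sigma> :: bool list. length \<sigma> = s \<and> P (take t \<sigma>)} = card {\<rho>. length \<rho> = t \<and> P \<rho>} * 2 ^ (s - t)"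
proof -
  have "bij_betw (\<lambda>(\<rho>, \<rho>'). \<rho> @ \<rho>') ({\<rho>. length \<rho> = t \<and> P \<rho>} \<times> {\<rho>'. length \<rho>' = s - t})
      {\<sigma> :: bool list. length \<sigma> = s \<and> P (take t \<sigma>)}"
    by (rule bij_betw_byWitness[where f'="\<lambda>\<sigma>. (take t \<sigma>, drop t \<sigma>)"]) (use assms in auto)
  from bij_betw_same_card[OF this] show ?thesis by (simp add: card_cartesian_product card_strings)
qed

lemma pref_length [simp]: "length (pref X n) = n"
  by (simp add: pref_def)

lemma take_pref: "take m (pref X n) = pref X (min m n)"
  by (cases "m \<le> n") (simp_all add: pref_def take_map)

text \<open>\<open>U s e x\<close> means that the \<open>e\<close>-th program with oracle \<open>A\<close> is seen to accept \<open>x\<close> by stage \<open>s\<close>.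
  The index \<open>e\<close> stands for the c.e. set of strings accepted by \<open>e\<close>, and \<open>k\<close> for the
  \<open>\<Pi>\<^sup>0\<^sub>2\<close> class \<open>\<Inter>\<^sub>n U\<^sub>n\<close> where \<open>U\<^sub>n\<close> is generated by the strings \<open>\<sigma>\<close> such that \<open>k\<close>
  accepts \<open>(n, \<sigma>)\<close>.\<close>

locale acceptance =
  fixes A :: "nat \<Rightarrow> bool" and U :: "nat \<Rightarrow> nat \<Rightarrow> nat \<Rightarrow> bool"
  assumes U_mono: "U s e x \<Longrightarrow> s \<le> t \<Longrightarrow> U t e x"
    and computable_U: "computable A (\<lambda>q. U (fst q) (fst (snd q)) (snd (snd q)))"
begin

text \<open>The cylinder of \<open>\<rho>\<close> is contained in \<open>U\<^sub>0 \<inter> \<dots> \<inter> U\<^sub>n\<close>, as far as visible at stage \<open>|\<rho>|\<close>.\<close>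

definition crosses :: "nat \<Rightarrow> nat \<Rightarrow> bool list \<Rightarrow> bool" where
  "crosses k n \<rho> \<longleftrightarrow>
     (\<forall>i\<le>n. \<exists>m\<le>length \<rho>. U (length \<rho>) k (prod_encode (i, bl_code (take m \<rho>))))"

text \<open>\<open>cost k n s / 2 ^ s\<close> is the measure of the part of \<open>U_0\<close>, ...,
  \<open>U_n\<close>'s intersection visible at stage \<open>s\<close>; counting strings keeps it a
  natural number.\<close>

definition cost :: "nat \<Rightarrow> nat \<Rightarrow> nat \<Rightarrow> nat" where
  "cost k n s = length (filter (crosses k n) (strings s))"

definition sat :: "nat \<Rightarrow> nat \<Rightarrow> bool list \<Rightarrow> bool" where
  "sat s e \<sigma> \<longleftrightarrow> (\<exists>m\<le>length \<sigma>. U s e (bl_code (take m \<sigma>)))"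

text \<open>Requirement \<open>e\<close> may replace \<open>\<sigma>\<close> by an extension of \<open>\<tau>\<close>, changing it only from position \<open>n\<close> on,
  if this injures no satisfied requirement of higher priority and \<open>U\<^sub>0 \<inter> \<dots> \<inter> U\<^sub>n\<close> has measure at
  most \<open>4\<^bsup>-e\<^esup> 2\<^bsup>-k-3\<^esup>\<close> so far.\<close>

definition eligible :: "nat \<Rightarrow> nat \<Rightarrow> bool list \<Rightarrow> nat \<Rightarrow> nat \<Rightarrow> bool list \<Rightarrow> bool" where
  "eligible k s \<sigma> e n \<tau> \<longleftrightarrow> n \<le> length \<sigma> \<and> n \<le> length \<tau> \<and> take n \<tau> = take n \<sigma> \<and>
     U s e (bl_code \<tau>) \<and> \<not> sat s e \<sigma> \<and> (\<forall>i<e. sat s i \<sigma> \<longrightarrow> sat s i (take n \<sigma>)) \<and>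
     cost k n s * 2 ^ (2 * e + k + 3) \<le> 2 ^ s"

text \<open>The searches below are bounded by artificial witnesses (\<open>e = s\<close>, \<open>n = |\<sigma>| + 1\<close>, \<open>c = s + 1\<close>);
  the latter two are never reached when \<open>act_req k s \<sigma> < s\<close>.\<close>

definition act_req :: "nat \<Rightarrow> nat \<Rightarrow> bool list \<Rightarrow> nat" where
  "act_req k s \<sigma> = (LEAST e. s \<le> e \<or> (\<exists>n\<le>length \<sigma>. \<exists>c\<le>s. eligible k s \<sigma> e n (bl_decode c)))"

definition act_pos :: "nat \<Rightarrow> nat \<Rightarrow> bool list \<Rightarrow> nat" where
  "act_pos k s \<sigma> = (LEAST n. length \<sigma> < n \<or> (\<exists>c\<le>s. eligible k s \<sigma> (act_req k s \<sigma>) n (bl_decode c)))"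

definition act_str :: "nat \<Rightarrow> nat \<Rightarrow> bool list \<Rightarrow> bool list" where
  "act_str k s \<sigma> =
     bl_decode (LEAST c. s < c \<or> eligible k s \<sigma> (act_req k s \<sigma>) (act_pos k s \<sigma>) (bl_decode c))"

text \<open>The padding with \<open>False\<close> prevents the string from getting shorter, and the
  extra bit at each stage gives \<open>s \<le> length (G k s)\<close>.\<close>

definition G :: "nat \<Rightarrow> nat \<Rightarrow> bool list" where
  "G k = rec_nat [] (\<lambda>s \<sigma>. (if act_req k s \<sigma> < s then act_str k s \<sigma> @ map (\<lambda>_. False) \<sigma> else \<sigma>) @ [False])"

definition acting :: "nat \<Rightarrow> nat \<Rightarrow> bool" where
  "acting k s \<longleftrightarrow> act_req k s (G k s) < s"

definition E :: "nat \<Rightarrow> nat \<Rightarrow> nat" where "E k s = act_req k s (G k s)"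

definition N :: "nat \<Rightarrow> nat \<Rightarrow> nat" where "N k s = act_pos k s (G k s)"

text \<open>An action at stage \<open>t\<close> charges the strings \<open>\<rho>\<close> of length
  \<open>t\<close> already seen inside the first \<open>N k t + 1\<close> open sets. A sequence
  avoiding them thus restrains where later actions may change \<open>G\<close>.\<close>

definition bad :: "nat \<Rightarrow> nat \<Rightarrow> bool list \<Rightarrow> bool" where
  "bad k t \<rho> \<longleftrightarrow> acting k t \<and> crosses k (N k t) \<rho>"

text \<open>The bounds on \<open>t\<close> and \<open>k\<close> keep membership decidable in
  \<open>A\<close>. Along a path every pair \<open>(k, t)\<close> is tested from level
  \<open>max k t\<close> on.\<close>

definition good_tree :: "bool list set" where
  "good_tree = {\<sigma>. \<forall>t\<le>length \<sigma>. \<forall>k\<le>length \<sigma>. \<not> bad k t (take t \<sigma>)}"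

section \<open>Computability of the construction in \<open>A\<close>\<close>

lemma computable_U_compose [comp_intros]:
  assumes "computable A f" "computable A g" "computable A h"
  shows "computable A (\<lambda>x. U (f x) (g x) (h x))"
  using computable_compose[OF computable_U computable_Pair[OF assms(1) computable_Pair[OF assms(2,3)]]]
  by simp

lemma computable_crosses [comp_intros]:
  assumes "computable A f" "computable A g" "computable A h"
  shows "computable A (\<lambda>x. crosses (f x) (g x) (h x))"
proof -
  have "computable A (\<lambda>q. crosses (fst q) (fst (snd q)) (snd (snd q)))"
    unfolding crosses_def by (intro comp_intros)
  from computable_compose[OF this computable_Pair[OF assms(1) computable_Pair[OF assms(2,3)]]]
  show ?thesis by simp
qed

lemma computable_cost [comp_intros]:
  assumes "computable A f" "computable A g" "computable A h"
  shows "computable A (\<lambda>x. cost (f x) (g x) (h x))"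
proof -
  have "computable A (\<lambda>q. cost (fst q) (fst (snd q)) (snd (snd q)))"
    unfolding cost_def by (intro comp_intros)
  from computable_compose[OF this computable_Pair[OF assms(1) computable_Pair[OF assms(2,3)]]]
  show ?thesis by simp
qed

lemma computable_sat [comp_intros]:
  assumes "computable A f" "computable A g" "computable A h"
  shows "computable A (\<lambda>x. sat (f x) (g x) (h x))"
proof -
  have "computable A (\<lambda>q. sat (fst q) (fst (snd q)) (snd (snd q)))"
    unfolding sat_def by (intro comp_intros)
  from computable_compose[OF this computable_Pair[OF assms(1) computable_Pair[OF assms(2,3)]]]
  show ?thesis by simp
qed

lemma computable_eligible [comp_intros]:
  assumes "computable A k" "computable A s" "computable A \<sigma>" "computable A e" "computable A n" "computable A \<tau>"
  shows "computable A (\<lambda>x. eligible (k x) (s x) (\<sigma> x) (e x) (n x) (\<tau> x))"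
proof -
  have "computable A (\<lambda>q. eligible (fst q) (fst (snd q)) (fst (snd (snd q))) (fst (snd (snd (snd q))))
      (fst (snd (snd (snd (snd q))))) (snd (snd (snd (snd (snd q))))))"
    unfolding eligible_def by (intro comp_intros)
  from computable_compose[OF this, of "\<lambda>x. (k x, s x, \<sigma> x, e x, n x, \<tau> x)"] show ?thesis
    using assms by (simp add: computable_Pair)
qed

lemma computable_act_req [comp_intros]:
  assumes "computable A f" "computable A g" "computable A h"
  shows "computable A (\<lambda>x. act_req (f x) (g x) (h x))"
proof -
  have "computable A (\<lambda>q. act_req (fst q) (fst (snd q)) (snd (snd q)))"
    unfolding act_req_def by (intro comp_intros) blast
  from computable_compose[OF this computable_Pair[OF assms(1) computable_Pair[OF assms(2,3)]]]
  show ?thesis by simp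
qed

lemma computable_act_pos [comp_intros]:
  assumes "computable A f" "computable A g" "computable A h"
  shows "computable A (\<lambda>x. act_pos (f x) (g x) (h x))"
proof -
  have "computable A (\<lambda>q. act_pos (fst q) (fst (snd q)) (snd (snd q)))"
    unfolding act_pos_def by (intro comp_intros) blast
  from computable_compose[OF this computable_Pair[OF assms(1) computable_Pair[OF assms(2,3)]]]
  show ?thesis by simp
qed

lemma computable_act_str [comp_intros]:
  assumes "computable A f" "computable A g" "computable A h"
  shows "computable A (\<lambda>x. act_str (f x) (g x) (h x))"
proof -
  have "computable A (\<lambda>q. act_str (fst q) (fst (snd q)) (snd (snd q)))"
    unfolding act_str_def by (intro comp_intros) blast
  from computable_compose[OF this computable_Pair[OF assms(1) computable_Pair[OF assms(2,3)]]]
  show ?thesis by simp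
qed

lemma computable_G [comp_intros]:
  assumes "computable A f" "computable A g"
  shows "computable A (\<lambda>x. G (f x) (g x))"
proof -
  have "computable A (\<lambda>q. G (fst q) (snd q))" unfolding G_def by (intro comp_intros)
  from computable_compose[OF this computable_Pair[OF assms]] show ?thesis by simp
qed

lemma computable_bad [comp_intros]:
  assumes "computable A f" "computable A g" "computable A h"
  shows "computable A (\<lambda>x. bad (f x) (g x) (h x))"
proof -
  have "computable A (\<lambda>q. bad (fst q) (fst (snd q)) (snd (snd q)))"
    unfolding bad_def acting_def N_def by (intro comp_intros)
  from computable_compose[OF this computable_Pair[OF assms(1) computable_Pair[OF assms(2,3)]]]
  show ?thesis by simp
qed

lemma turing_red_good_tree: "turing_red (\<lambda>k. \<exists>\<sigma>\<in>good_tree. bl_code \<sigma> = k) A"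
proof -
  have "computable A (\<lambda>c. bl_code (bl_decode c) = c \<and> (\<forall>t\<le>length (bl_decode c).
      \<forall>k\<le>length (bl_decode c). \<not> bad k t (take t (bl_decode c))))"
    by (intro comp_intros)
  moreover have "(bl_code (bl_decode c) = c \<and> (\<forall>t\<le>length (bl_decode c).
      \<forall>k\<le>length (bl_decode c). \<not> bad k t (take t (bl_decode c)))) \<longleftrightarrow>
      (\<exists>\<sigma>\<in>good_tree. bl_code \<sigma> = c)" for c
    by (auto simp: good_tree_def intro!: exI[of _ "bl_decode c"])
  ultimately show ?thesis by (simp add: computable_iff_turing_red)
qed

lemma binary_tree_good_tree: "binary_tree good_tree"
  unfolding binary_tree_def
proof (intro allI impI)
  fix \<sigma> \<tau> assume *: "\<sigma> @ \<tau> \<in> good_tree"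
  have "\<not> bad k t (take t \<sigma>)" if "t \<le> length \<sigma>" "k \<le> length \<sigma>" for k t
  proof -
    have "\<not> bad k t (take t (\<sigma> @ \<tau>))"
      using * that unfolding good_tree_def by (auto simp del: take_append)
    then show ?thesis using that by simp
  qed
  then show "\<sigma> \<in> good_tree" by (simp add: good_tree_def)
qed

section \<open>Monotonicity and the effect of a single stage\<close>

lemma crosses_mono:
  assumes "crosses k n \<rho>" "n' \<le> n" shows "crosses k n' (\<rho> @ \<rho>')"
  unfolding crosses_def
proof (intro allI impI)
  fix i assume "i \<le> n'"
  then obtain m where "m \<le> length \<rho>" "U (length \<rho>) k (prod_encode (i, bl_code (take m \<rho>)))"
    using assms unfolding crosses_def by (meson order_trans)
  then show "\<exists>m\<le>length (\<rho> @ \<rho>'). U (length (\<rho> @ \<rho>')) k (prod_encode (i, bl_code (take m (\<rho> @ \<rho>'))))"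
    by (intro exI[of _ m]) (auto intro: U_mono)
qed

lemma crosses_pref_mono:
  assumes "crosses k n (pref X s)" "n' \<le> n" "s \<le> t" shows "crosses k n' (pref X t)"
proof -
  have "pref X t = pref X s @ drop s (pref X t)"
    using assms(3) by (metis append_take_drop_id min.absorb1 take_pref)
  then show ?thesis using crosses_mono[OF assms(1,2)] by metis
qed

lemma sat_mono:
  assumes "sat s e \<sigma>" "s \<le> t" shows "sat t e (\<sigma> @ \<rho>)"
proof -
  obtain m where "m \<le> length \<sigma>" "U s e (bl_code (take m \<sigma>))" using assms unfolding sat_def by blast
  then show ?thesis unfolding sat_def using assms(2) by (intro exI[of _ m]) (auto intro: U_mono)
qed

lemma G_0 [simp]: "G k 0 = []"
  by (simp add: G_def)

lemma G_Suc_idle: "\<not> acting k s \<Longrightarrow> G k (Suc s) = G k s @ [False]"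
  by (simp add: G_def acting_def)

text \<open>Once the first search stops below \<open>s\<close>, its result is genuine and supplies a
  witness within the bounds of the second search, which in turn does so for the third.\<close>

lemma G_Suc_acting:
  assumes "acting k s"
  obtains \<tau> where "eligible k s (G k s) (E k s) (N k s) \<tau>"
    "G k (Suc s) = \<tau> @ map (\<lambda>_. False) (G k s) @ [False]"
proof -
  let ?\<sigma> = "G k s"
  let ?P = "\<lambda>e. s \<le> e \<or> (\<exists>n\<le>length ?\<sigma>. \<exists>c\<le>s. eligible k s ?\<sigma> e n (bl_decode c))"
  have "?P (E k s)" unfolding E_def act_req_def by (rule LeastI[of ?P s]) simp
  then obtain n c where n: "n \<le> length ?\<sigma>" "c \<le> s" "eligible k s ?\<sigma> (E k s) n (bl_decode c)"
    using assms by (auto simp: acting_def E_def)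
  let ?Q = "\<lambda>n. length ?\<sigma> < n \<or> (\<exists>c\<le>s. eligible k s ?\<sigma> (E k s) n (bl_decode c))"
  have Q: "?Q n" using n by blast
  have "N k s = (LEAST n. ?Q n)" by (simp add: N_def act_pos_def E_def)
  with LeastI[of ?Q, OF Q] Least_le[of ?Q, OF Q] n(1)
  obtain c where c: "c \<le> s" "eligible k s ?\<sigma> (E k s) (N k s) (bl_decode c)" by auto
  let ?R = "\<lambda>c. s < c \<or> eligible k s ?\<sigma> (E k s) (N k s) (bl_decode c)"
  have R: "?R c" using c by blast
  have "act_str k s ?\<sigma> = bl_decode (LEAST c. ?R c)" by (simp add: N_def act_str_def E_def)
  with LeastI[of ?R, OF R] Least_le[of ?R, OF R] c(1)
  have "eligible k s ?\<sigma> (E k s) (N k s) (act_str k s ?\<sigma>)" by auto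
  moreover have "G k (Suc s) = act_str k s ?\<sigma> @ map (\<lambda>_. False) (G k s) @ [False]"
    using assms by (simp add: G_def acting_def)
  ultimately show thesis by (rule that)
qed

text \<open>The bounds on \<open>e\<close> and on the code of \<open>\<tau>\<close> place the triple
  within the range of the search for \<open>act_req\<close>.\<close>

lemma acting_if_eligible:
  assumes "eligible k s (G k s) e n \<tau>" "e < s" "bl_code \<tau> \<le> s"
  shows "acting k s" "E k s \<le> e"
proof -
  have "n \<le> length (G k s)" using assms(1) by (simp add: eligible_def)
  then have "\<exists>n\<le>length (G k s). \<exists>c\<le>s. eligible k s (G k s) e n (bl_decode c)"
    using assms by (intro exI[of _ n] conjI exI[of _ "bl_code \<tau>"]) auto
  then show "E k s \<le> e" unfolding E_def act_req_def by (intro Least_le) blast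
  then show "acting k s" using assms(2) by (simp add: acting_def E_def)
qed

lemma length_G: "s \<le> length (G k s)"
proof (induction s)
  case (Suc s)
  then show ?case by (cases "acting k s") (auto simp: G_Suc_idle elim: G_Suc_acting)
qed simp

text \<open>An action of a requirement beyond \<open>i\<close> keeps the first \<open>N k s\<close>
  bits, and by eligibility \<open>i\<close> is already satisfied within them. If
  \<open>m \<le> N k s\<close>, the first \<open>m\<close> bits do not change; otherwise they
  include the protected ones.\<close>

lemma sat_preserved:
  assumes "sat s i (take m (G k s))" "acting k s \<Longrightarrow> i < E k s"
  shows "sat (Suc s) i (take m (G k (Suc s)))"
proof (cases "acting k s")
  case False
  then show ?thesis using sat_mono[OF assms(1), of "Suc s"] by (simp add: G_Suc_idle)
next
  case True
  then obtain \<tau> where \<tau>: "eligible k s (G k s) (E k s) (N k s) \<tau>"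
    "G k (Suc s) = \<tau> @ map (\<lambda>_. False) (G k s) @ [False]" by (rule G_Suc_acting)
  let ?n = "N k s"
  have take: "take ?n (G k (Suc s)) = take ?n (G k s)" using \<tau> by (simp add: eligible_def)
  have "sat s i (G k s)"
    using sat_mono[OF assms(1) order_refl, of "drop m (G k s)"] by simp
  then have n: "sat s i (take ?n (G k s))" using \<tau>(1) assms(2)[OF True] by (simp add: eligible_def)
  show ?thesis
  proof (cases "m \<le> ?n")
    case True
    then have "take m (G k (Suc s)) = take m (G k s)"
      using take by (metis min.absorb1 take_take)
    then show ?thesis using sat_mono[OF assms(1), of "Suc s" "[]"] by simp
  next
    case False
    then have "take m (G k (Suc s)) = take ?n (G k s) @ drop ?n (take m (G k (Suc s)))"
      using take by (metis append_take_drop_id linear min.absorb1 take_take)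
    then show ?thesis using sat_mono[OF n, of "Suc s"] by (metis le_SucI order_refl)
  qed
qed

lemma sat_preserved': "sat s i (G k s) \<Longrightarrow> (acting k s \<Longrightarrow> i < E k s) \<Longrightarrow> sat (Suc s) i (G k (Suc s))"
  using sat_preserved[of s i "max (length (G k s)) (length (G k (Suc s)))" k] by simp

lemma acting_sat:
  assumes "acting k s"
  shows "\<not> sat s (E k s) (G k s)" "sat (Suc s) (E k s) (G k (Suc s))"
    "cost k (N k s) s * 2 ^ (2 * E k s + k + 3) \<le> 2 ^ s"
proof -
  obtain \<tau> where \<tau>: "eligible k s (G k s) (E k s) (N k s) \<tau>"
    "G k (Suc s) = \<tau> @ map (\<lambda>_. False) (G k s) @ [False]"
    using assms by (rule G_Suc_acting)
  then show "\<not> sat s (E k s) (G k s)" "cost k (N k s) s * 2 ^ (2 * E k s + k + 3) \<le> 2 ^ s"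
    by (auto simp: eligible_def)
  have "sat s (E k s) \<tau>" unfolding sat_def using \<tau>(1) by (intro exI[of _ "length \<tau>"]) (simp add: eligible_def)
  then show "sat (Suc s) (E k s) (G k (Suc s))" using sat_mono[of s] \<tau>(2) by simp
qed

text \<open>An action of \<open>e\<close> satisfies \<open>e\<close> and can injure only requirements beyond \<open>e\<close>, whose total weight is
  a third of that of \<open>e\<close>; so it lowers the potential by at least half the weight of \<open>e\<close>.\<close>

definition potential :: "nat \<Rightarrow> nat \<Rightarrow> nat \<Rightarrow> real" where
  "potential k M s = (\<Sum>e<M. if sat s e (G k s) then 0 else (1/4) ^ e)"

lemma geometric_quarter: "(\<Sum>e=a..<b. (1/4 :: real) ^ e) \<le> 4/3 * (1/4) ^ a"
proof (cases "a \<le> b")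
  case True
  then have "(\<Sum>e=a..<b. (1/4 :: real) ^ e) = 4/3 * ((1/4) ^ a - (1/4) ^ b)"
    by (induction b rule: dec_induct) auto
  then show ?thesis by simp
qed simp

lemma potential_step:
  assumes "s \<le> M"
  shows "potential k M (Suc s) + (if acting k s then (1/4) ^ E k s / 2 else 0) \<le> potential k M s"
proof (cases "acting k s")
  case False
  then have "potential k M (Suc s) \<le> potential k M s"
    unfolding potential_def using sat_preserved'[of s _ k] by (intro sum_mono) auto
  with False show ?thesis by simp
next
  case True
  define u where "u s e = (if sat s e (G k s) then 0 else (1/4 :: real) ^ e)" for s e
  let ?E = "E k s"
  have EM: "?E < M" using True assms by (simp add: acting_def E_def)
  have split: "potential k M t = (\<Sum>e<?E. u t e) + u t ?E + (\<Sum>e=Suc ?E..<M. u t e)" for t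
    using EM sum.atLeastLessThan_concat[of 0 "Suc ?E" M "u t"]
    unfolding potential_def u_def[symmetric] by (simp add: atLeast0LessThan)
  have "(\<Sum>e<?E. u (Suc s) e) \<le> (\<Sum>e<?E. u s e)"
    unfolding u_def using sat_preserved'[of s _ k] by (intro sum_mono) auto
  moreover have "u (Suc s) ?E = 0" "u s ?E = (1/4) ^ ?E"
    using acting_sat[OF True] by (simp_all add: u_def)
  moreover have "(\<Sum>e=Suc ?E..<M. u (Suc s) e) \<le> (\<Sum>e=Suc ?E..<M. (1/4) ^ e)"
    by (rule sum_mono) (simp add: u_def)
  moreover have "0 \<le> (\<Sum>e=Suc ?E..<M. u s e)"
    by (rule sum_nonneg) (simp add: u_def)
  moreover have "(\<Sum>e=Suc ?E..<M. (1/4 :: real) ^ e) \<le> (1/4) ^ ?E / 3"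
    using geometric_quarter[of "Suc ?E" M] by simp
  moreover have "(1/4 :: real) ^ ?E \<ge> 0" by simp
  ultimately have "potential k M (Suc s) + (1/4) ^ ?E / 2 \<le> potential k M s"
    unfolding split by linarith
  then show ?thesis using True by simp
qed

text \<open>The potential starts at no more than 4/3, never becomes negative, and drops by half the
  weight of each action. The cut-off \<open>M = s\<close> covers every requirement that can act
  before stage \<open>s\<close>.\<close>

lemma sum_acting: "(\<Sum>t<s. if acting k t then (1/4 :: real) ^ E k t else 0) \<le> 8/3"
proof -
  have "potential k s r + (\<Sum>t<r. if acting k t then (1/4 :: real) ^ E k t else 0) / 2 \<le> potential k s 0"
    if "r \<le> s" for r
    using that
  proof (induction r)
    case (Suc r)
    then show ?case using potential_step[of r s k] by (cases "acting k r") (auto simp: add_divide_distrib)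
  qed simp
  from this[of s] have "potential k s s + (\<Sum>t<s. if acting k t then (1/4 :: real) ^ E k t else 0) / 2 \<le> potential k s 0"
    by simp
  moreover have "0 \<le> potential k s s" unfolding potential_def by (rule sum_nonneg) simp
  moreover have "potential k s 0 \<le> (\<Sum>e=0..<s. (1/4 :: real) ^ e)"
    unfolding potential_def by (subst atLeast0LessThan) (rule sum_mono, simp)
  moreover note geometric_quarter[of 0 s]
  ultimately show ?thesis by simp
qed

text \<open>Finite injury: \<open>3 * 4 ^ e\<close> such actions, each of weight at least
  \<open>(1/4) ^ e\<close>, would total 3, more than the 8/3 of \<open>sum_acting\<close>.\<close>

lemma acting_finite: "finite {t. acting k t \<and> E k t \<le> e}"
proof (rule ccontr)
  assume "infinite {t. acting k t \<and> E k t \<le> e}"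
  then obtain F where F: "F \<subseteq> {t. acting k t \<and> E k t \<le> e}" "finite F" "card F = 3 * 4 ^ e"
    using infinite_arbitrarily_large by blast
  obtain s where s: "F \<subseteq> {..<s}" using finite_nat_iff_bounded F(2) by blast
  have "3 = (\<Sum>t\<in>F. (1/4 :: real) ^ e)" using F(3) by (simp add: power_one_over)
  also have "\<dots> \<le> (\<Sum>t\<in>F. if acting k t then (1/4 :: real) ^ E k t else 0)"
    using F(1) by (intro sum_mono) (auto intro: power_decreasing)
  also have "\<dots> \<le> (\<Sum>t<s. if acting k t then (1/4 :: real) ^ E k t else 0)"
    using s by (intro sum_mono2) auto
  also note sum_acting
  finally show False by simp
qed

section \<open>The measure of the bad strings\<close>

lemma card_bad: "real (card {\<rho>. length \<rho> = t \<and> bad k t \<rho>}) \<le>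
   (if acting k t then (1/4) ^ E k t else 0) * (1/2) ^ k / 8 * 2 ^ t"
proof (cases "acting k t")
  case True
  have "card {\<rho>. length \<rho> = t \<and> bad k t \<rho>} = cost k (N k t) t"
    using True by (simp add: cost_def length_filter_strings bad_def)
  \<comment> \<open>The cost clause of eligibility at the moment of the action.\<close>
  then have "real (card {\<rho>. length \<rho> = t \<and> bad k t \<rho>}) * 2 ^ (2 * E k t + k + 3) \<le> 2 ^ t"
    using of_nat_mono[where ?'a=real, OF acting_sat(3)[OF True]] by simp
  then show ?thesis using True
    by (simp add: power_add power_mult power_one_over field_simps)
qed (simp add: bad_def)

text \<open>Union bound: by \<open>card_bad\<close> and \<open>sum_acting\<close> the strings bad
  for \<open>k\<close> form at most a fraction \<open>(1/2) ^ k / 3\<close> of the level, and these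
  fractions add up to less than 1.\<close>

lemma good_tree_level: "\<exists>\<sigma>\<in>good_tree. length \<sigma> = s"
proof (rule ccontr)
  assume "\<not> ?thesis"
  then have "{\<sigma>. length \<sigma> = s} \<subseteq> (\<Union>k\<le>s. \<Union>t\<le>s. {\<sigma>. length \<sigma> = s \<and> bad k t (take t \<sigma>)})"
    unfolding good_tree_def by fastforce
  then have "card {\<sigma> :: bool list. length \<sigma> = s} \<le> card (\<Union>k\<le>s. \<Union>t\<le>s. {\<sigma>. length \<sigma> = s \<and> bad k t (take t \<sigma>)})"
    by (rule card_mono[rotated]) (auto intro: finite_strings)
  also have "\<dots> \<le> (\<Sum>k\<le>s. \<Sum>t\<le>s. card {\<sigma>. length \<sigma> = s \<and> bad k t (take t \<sigma>)})"
    by (intro order_trans[OF card_UN_le] sum_mono) auto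
  finally have "real (2 ^ s) \<le> (\<Sum>k\<le>s. \<Sum>t\<le>s. real (card {\<sigma>. length \<sigma> = s \<and> bad k t (take t \<sigma>)}))"
    unfolding card_strings of_nat_sum[symmetric] of_nat_le_iff .
  also have "\<dots> \<le> (\<Sum>k\<le>s. \<Sum>t\<le>s. 2 ^ s * (1/2) ^ k / 8 * (if acting k t then (1/4) ^ E k t else 0))"
  proof (intro sum_mono)
    fix k t assume "t \<in> {..s}"
    then have "t \<le> s" by simp
    then have "real (card {\<sigma>. length \<sigma> = s \<and> bad k t (take t \<sigma>)}) =
        real (card {\<rho>. length \<rho> = t \<and> bad k t \<rho>}) * 2 ^ (s - t)"
      by (simp add: card_extensions)
    also have "\<dots> \<le> ((if acting k t then (1/4) ^ E k t else 0) * (1/2) ^ k / 8 * 2 ^ t) * 2 ^ (s - t)"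
      by (intro mult_right_mono card_bad) simp
    also have "\<dots> = 2 ^ s * (1/2) ^ k / 8 * (if acting k t then (1/4) ^ E k t else 0)"
      using \<open>t \<le> s\<close> power_add[of "2::real" t "s - t"] by simp
    finally show "real (card {\<sigma>. length \<sigma> = s \<and> bad k t (take t \<sigma>)}) \<le>
      2 ^ s * (1/2) ^ k / 8 * (if acting k t then (1/4) ^ E k t else 0)" .
  qed
  also have "\<dots> = (\<Sum>k\<le>s. 2 ^ s * (1/2) ^ k / 8 * (\<Sum>t<Suc s. if acting k t then (1/4) ^ E k t else 0))"
    by (simp only: sum_distrib_left lessThan_Suc_atMost)
  also have "\<dots> \<le> (\<Sum>k\<le>s. 2 ^ s * (1/2) ^ k / 8 * (8/3))"
    by (intro sum_mono mult_left_mono sum_acting) simp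
  also have "\<dots> = 2 ^ s / 3 * (\<Sum>k\<le>s. (1/2) ^ k)"
    by (simp add: sum_distrib_left)
  also have "\<dots> < 2 ^ s / 3 * 3"
  proof (rule mult_strict_left_mono)
    have "(\<Sum>k<Suc s. (1/2 :: real) ^ k) = (1 - (1/2) ^ Suc s) / (1 - 1/2)"
      by (subst sum_gp_strict) simp
    also have "\<dots> < 3" by (simp add: power_one_over field_simps add_strict_increasing)
    finally show "(\<Sum>k\<le>s. (1/2 :: real) ^ k) < 3" by (simp only: lessThan_Suc_atMost)
  qed simp
  finally show False by simp
qed

lemma infinite_good_tree: "infinite good_tree"
proof
  assume "finite good_tree"
  then have "finite (length ` good_tree)" by simp
  moreover have "UNIV \<subseteq> length ` good_tree" using good_tree_level by (metis image_eqI subsetI)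
  ultimately show False using finite_subset infinite_UNIV_nat by blast
qed

lemma path_avoids_bad:
  assumes "is_path X good_tree" shows "\<not> bad k t (pref X t)"
proof -
  have "pref X (max k t) \<in> good_tree" using assms by (simp add: is_path_def)
  then show ?thesis by (auto simp: good_tree_def take_pref dest!: spec[of _ t])
qed

subsection \<open>The limit is generic\<close>

lemma crosses_pref_iff:
  "(\<forall>n. \<exists>s. crosses k n (pref Y s)) \<longleftrightarrow> (\<forall>n. \<exists>m s. U s k (prod_encode (n, bl_code (pref Y m))))"
proof (intro iffI allI)
  fix n assume "\<forall>n. \<exists>s. crosses k n (pref Y s)"
  then obtain s where "crosses k n (pref Y s)" by blast
  then obtain m where "m \<le> s" "U s k (prod_encode (n, bl_code (take m (pref Y s))))"
    unfolding crosses_def by auto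
  then show "\<exists>m s. U s k (prod_encode (n, bl_code (pref Y m)))"
    by (auto simp: take_pref min_absorb1)
next
  fix n assume "\<forall>n. \<exists>m s. U s k (prod_encode (n, bl_code (pref Y m)))"
  then obtain m s where ms: "\<And>i. U (s i) k (prod_encode (i, bl_code (pref Y (m i))))" by metis
  \<comment> \<open>Finitely many witnesses are involved, and the sum dominates each of them, both
    as length and as stage.\<close>
  let ?t = "\<Sum>i\<le>n. m i + s i"
  have "\<exists>j\<le>?t. U ?t k (prod_encode (i, bl_code (take j (pref Y ?t))))" if "i \<le> n" for i
  proof -
    have "m i + s i \<le> ?t" using that by (intro member_le_sum) auto
    then show ?thesis using U_mono[OF ms[of i], of ?t]
      by (intro exI[of _ "m i"]) (auto simp: take_pref min_absorb1)
  qed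
  then show "\<exists>s. crosses k n (pref Y s)" unfolding crosses_def by (intro exI[of _ ?t]) simp
qed

lemma sat_take_mono:
  assumes "sat s i (take l \<sigma>)" "l \<le> n" shows "sat s i (take n \<sigma>)"
proof -
  have "take l \<sigma> @ drop l (take n \<sigma>) = take n \<sigma>"
    using append_take_drop_id[of l "take n \<sigma>"] assms(2) by (simp add: min_absorb1)
  then show ?thesis using sat_mono[OF assms(1) order_refl, of "drop l (take n \<sigma>)"] by simp
qed

text \<open>From stage \<open>settle k X x\<close> on, a change at position \<open>x\<close> would make an initial segment of \<open>X\<close> bad.\<close>

definition settle :: "nat \<Rightarrow> (nat \<Rightarrow> bool) \<Rightarrow> nat \<Rightarrow> nat" where
  "settle k X x = (LEAST s. x < s \<and> crosses k x (pref X s))"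

text \<open>\<open>hd (drop x _)\<close> is the entry at \<open>x\<close> in a form covered by the
  closure rules; it exists because \<open>settle k X x\<close> exceeds \<open>x\<close>.\<close>

definition generic :: "nat \<Rightarrow> (nat \<Rightarrow> bool) \<Rightarrow> nat \<Rightarrow> bool" where
  "generic k X x = hd (drop x (G k (settle k X x)))"

lemma ex_settle:
  assumes "\<And>n. \<exists>s. crosses k n (pref X s)" shows "\<exists>s>x. crosses k x (pref X s)"
proof -
  obtain s where "crosses k x (pref X s)" using assms by blast
  then show ?thesis
    by (intro exI[of _ "max s (Suc x)"]) (auto intro: crosses_pref_mono)
qed

text \<open>The search for \<open>settle\<close> consults \<open>X\<close>, while
  \<open>crosses\<close> and \<open>G\<close> need only \<open>A\<close>; it terminates because
  \<open>X\<close> crosses every level.\<close>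

lemma computable_generic:
  assumes "\<And>n. \<exists>s. crosses k n (pref X s)"
  shows "computable (join X A) (generic k X)"
proof -
  note change = computable_change_oracle[OF computable_join_right]
  have "computable (join X A) (\<lambda>q. crosses k (fst q) (snd q))"
    by (rule change) (intro comp_intros)
  from computable_compose[OF this, of "\<lambda>q. (fst q, pref X (snd q))"]
  have cr: "computable (join X A) (\<lambda>q. crosses k (fst q) (pref X (snd q)))"
    by (simp add: comp_intros computable_join_left)
  have "computable (join X A) (settle k X)"
    unfolding settle_def using ex_settle[OF assms] by (intro comp_intros cr) blast
  moreover have "computable (join X A) (G k)"
    by (rule change) (intro comp_intros)
  ultimately have "computable (join X A) (\<lambda>x. G k (settle k X x))"
    using computable_compose by blast
  then show ?thesis unfolding generic_def by (intro comp_intros)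
qed

context
  fixes X :: "nat \<Rightarrow> bool" and k :: nat
  assumes avoids: "\<And>t. \<not> bad k t (pref X t)"
    and in_class: "\<And>n. \<exists>s. crosses k n (pref X s)"
begin

lemma settle: "x < settle k X x" "crosses k x (pref X (settle k X x))"
  using LeastI_ex[OF ex_settle[OF in_class, of x]] by (simp_all add: settle_def)

lemma G_settled: "settle k X x \<le> t \<Longrightarrow> G k t ! x = generic k X x"
proof (induction t rule: dec_induct)
  case base
  have "x < length (G k (settle k X x))" using settle(1) length_G by (meson less_le_trans)
  then show ?case by (simp add: generic_def hd_drop_conv_nth)
next
  case (step t)
  have x: "x < length (G k t)" using settle(1)[of x] length_G[of t k] step.hyps by linarith
  show ?case
  proof (cases "acting k t")
    case False
    then show ?thesis using step.IH x by (simp add: G_Suc_idle nth_append)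
  next
    case True
    then obtain \<tau> where \<tau>: "eligible k t (G k t) (E k t) (N k t) \<tau>"
      "G k (Suc t) = \<tau> @ map (\<lambda>_. False) (G k t) @ [False]" by (rule G_Suc_acting)
    \<comment> \<open>Otherwise \<open>pref X t\<close> would have crossed level
      \<open>N k t\<close> and this very action would make it bad.\<close>
    have "x < N k t"
    proof (rule ccontr)
      assume "\<not> x < N k t"
      then have "crosses k (N k t) (pref X t)"
        using crosses_pref_mono[OF settle(2)[of x], of "N k t" t] step.hyps(1) by simp
      then show False using avoids True by (simp add: bad_def)
    qed
    moreover have "take (N k t) \<tau> = take (N k t) (G k t)" "N k t \<le> length \<tau>"
      using \<tau>(1) by (auto simp: eligible_def)
    ultimately have "G k (Suc t) ! x = G k t ! x"
      using \<tau>(2) by (metis nth_append nth_take order_less_le_trans)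
    then show ?thesis using step.IH by simp
  qed
qed

lemma take_G_settled:
  assumes "n \<le> t" "\<And>x. x < n \<Longrightarrow> settle k X x \<le> t"
  shows "take n (G k t) = pref (generic k X) n"
proof (rule nth_equalityI)
  have "n \<le> length (G k t)" using assms(1) length_G[of t k] by linarith
  then show "length (take n (G k t)) = length (pref (generic k X) n)" by simp
  fix i assume "i < length (take n (G k t))"
  then show "take n (G k t) ! i = pref (generic k X) n ! i"
    using G_settled assms(2) by (simp add: pref_def)
qed

text \<open>After the last action of a requirement up to \<open>e\<close>, a satisfied
  \<open>e\<close> stays satisfied in the limit. If it is unsatisfied and the set is dense along the
  limit, then \<open>e\<close> becomes eligible at a late stage, which forces one more such
  action.\<close>

lemma generic_meets_or_avoids:
  assumes cheap: "\<And>D. \<exists>n0. \<forall>n\<ge>n0. \<forall>s. cost k n s * D \<le> 2 ^ s"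
  shows "(\<exists>n s. U s e (bl_code (pref (generic k X) n))) \<or>
    (\<exists>n. \<forall>\<tau> s. U s e (bl_code \<tau>) \<longrightarrow> \<not> (\<exists>\<rho>. \<tau> = pref (generic k X) n @ \<rho>))"
proof (rule disjCI)
  assume "\<not> (\<exists>n. \<forall>\<tau> s. U s e (bl_code \<tau>) \<longrightarrow> \<not> (\<exists>\<rho>. \<tau> = pref (generic k X) n @ \<rho>))"
  then have dense: "\<exists>\<rho> s. U s e (bl_code (pref (generic k X) n @ \<rho>))" for n by blast
  let ?H = "generic k X"
  obtain s0 where s0: "\<And>t. s0 \<le> t \<Longrightarrow> acting k t \<Longrightarrow> e < E k t"
  proof -
    obtain b where "{t. acting k t \<and> E k t \<le> e} \<subseteq> {..<b}"
      using acting_finite finite_nat_iff_bounded by blast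
    then show thesis by (intro that[of b]) (force simp: not_le[symmetric])
  qed
  have persist: "sat t' i (take m (G k t'))"
    if "i \<le> e" "s0 \<le> t" "t \<le> t'" "sat t i (take m (G k t))" for i t t' m
    using that(3)
  proof (induction t' rule: dec_induct)
    case (step r)
    then show ?case using s0[of r] that by (intro sat_preserved) auto
  qed (rule that(4))
  show "\<exists>n s. U s e (bl_code (pref ?H n))"
  proof (cases "\<exists>t\<ge>s0. sat t e (G k t)")
    case True
    then obtain t where t: "s0 \<le> t" "sat t e (take (length (G k t)) (G k t))" by auto
    let ?m = "length (G k t)"
    \<comment> \<open>Late enough for the first \<open>?m\<close> bits to have reached their
      limit.\<close>
    let ?t = "t + ?m + (\<Sum>x<?m. settle k X x)"
    have "sat ?t e (take ?m (G k ?t))" using persist[OF _ t(1) _ t(2), of ?t] by simp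
    also have "take ?m (G k ?t) = pref ?H ?m"
    proof (rule take_G_settled)
      fix x assume "x < ?m"
      then have "settle k X x \<le> (\<Sum>x<?m. settle k X x)" by (intro member_le_sum) auto
      then show "settle k X x \<le> ?t" by simp
    qed simp
    finally show ?thesis unfolding sat_def by (auto simp: take_pref)
  next
    case False
    obtain n0 where n0: "\<And>n s. n0 \<le> n \<Longrightarrow> cost k n s * 2 ^ (2 * e + k + 3) \<le> 2 ^ s"
      using cheap by blast
    \<comment> \<open>A requirement \<open>i < e\<close> satisfied at some stage from
      \<open>s0\<close> on remains satisfied within a fixed length; if there is no such stage, the
      condition is vacuous.\<close>
    have "\<exists>l r. s0 \<le> r \<and> (i < e \<longrightarrow> (\<forall>t\<ge>r. sat t i (G k t) \<longrightarrow> sat t i (take l (G k t))))" for i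
    proof (cases "i < e \<and> (\<exists>t\<ge>s0. sat t i (G k t))")
      case True
      then obtain t where "s0 \<le> t" "sat t i (take (length (G k t)) (G k t))" by auto
      then show ?thesis
        using persist[of i t] True by (intro exI[of _ "length (G k t)"] exI[of _ t]) auto
    qed auto
    then obtain l r where lr: "\<And>i. s0 \<le> r i"
      "\<And>i t. i < e \<Longrightarrow> r i \<le> t \<Longrightarrow> sat t i (G k t) \<Longrightarrow> sat t i (take (l i) (G k t))" by metis
    \<comment> \<open>From \<open>n0\<close> on the cost is low enough for \<open>e\<close>; the
      lengths \<open>l i\<close> protect the requirements of higher priority.\<close>
    let ?n = "n0 + (\<Sum>i<e. l i)"
    obtain \<rho> s where \<rho>: "U s e (bl_code (pref ?H ?n @ \<rho>))" using dense by blast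
    let ?\<tau> = "pref ?H ?n @ \<rho>"
    \<comment> \<open>The summands ensure, in order: no more actions up to \<open>e\<close>,
      protection of each \<open>i < e\<close>, enumeration of \<open>?\<tau>\<close>, the search
      bounds for \<open>e\<close> and \<open>?\<tau>\<close>, settled bits below \<open>?n\<close>,
      and sufficient length.\<close>
    let ?t = "s0 + (\<Sum>i<e. r i) + s + Suc e + bl_code ?\<tau> + (\<Sum>x<?n. settle k X x) + ?n"
    have take: "take ?n (G k ?t) = pref ?H ?n"
    proof (rule take_G_settled)
      fix x assume "x < ?n"
      then have "settle k X x \<le> (\<Sum>x<?n. settle k X x)" by (intro member_le_sum) auto
      then show "settle k X x \<le> ?t" by linarith
    qed simp
    have "eligible k ?t (G k ?t) e ?n ?\<tau>"
      unfolding eligible_def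
    proof (intro conjI allI impI)
      show "?n \<le> length (G k ?t)" by (rule order_trans[OF _ length_G]) linarith
      show "take ?n ?\<tau> = take ?n (G k ?t)" unfolding take by simp
      show "U ?t e (bl_code ?\<tau>)" using \<rho> by (rule U_mono) linarith
      show "\<not> sat ?t e (G k ?t)" using False by (meson le_add1 order_trans)
      show "cost k ?n ?t * 2 ^ (2 * e + k + 3) \<le> 2 ^ ?t" by (rule n0) simp
    next
      fix i assume i: "i < e" "sat ?t i (G k ?t)"
      have "r i \<le> (\<Sum>i<e. r i)" using i(1) by (intro member_le_sum) auto
      then have "sat ?t i (take (l i) (G k ?t))" using i by (intro lr(2)) linarith+
      moreover have "l i \<le> ?n"
        using i(1) member_le_sum[of i "{..<e}" l] by (simp add: trans_le_add2)
      ultimately show "sat ?t i (take ?n (G k ?t))" by (rule sat_take_mono)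
    qed simp
    then have "acting k ?t" "E k ?t \<le> e" by (rule acting_if_eligible; linarith)+
    then show ?thesis using s0[of ?t] by simp
  qed
qed

end

end

section \<open>Lebesgue measure on Cantor space\<close>

lemma prob_space_cantor_measure: "prob_space cantor_measure"
  unfolding cantor_measure_def by (intro prob_space_PiM measure_pmf.prob_space_axioms)

lemma cylinder:
  assumes "length \<rho> = n"
  shows "{Y. pref Y n = \<rho>} \<in> sets cantor_measure" "measure cantor_measure {Y. pref Y n = \<rho>} = (1/2) ^ n"
proof -
  let ?M = "\<lambda>_::nat. measure_pmf (bernoulli_pmf (1/2))"
  interpret product_prob_space ?M UNIV by (intro product_prob_spaceI prob_space_measure_pmf)
  have eq: "{Y. pref Y n = \<rho>} = {Y \<in> space (PiM UNIV ?M). \<forall>i\<in>{..<n}. Y i \<in> {\<rho> ! i}}"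
    using assms by (auto simp: space_PiM pref_def list_eq_iff_nth_eq)
  show "{Y. pref Y n = \<rho>} \<in> sets cantor_measure"
    unfolding eq cantor_measure_def
    by (intro sets.sets_Collect_finite_All sets_Collect_single) auto
  have half: "emeasure (measure_pmf (bernoulli_pmf (1/2))) {b} = ennreal (1/2)" for b
    by (cases b) (simp_all add: emeasure_pmf_single)
  have "emeasure cantor_measure {Y. pref Y n = \<rho>} = (\<Prod>i<n. ennreal (1/2))"
    unfolding eq cantor_measure_def by (subst emeasure_PiM_Collect) (simp_all add: half)
  also have "\<dots> = ennreal ((1/2) ^ n)" by (simp only: prod_constant card_lessThan ennreal_power)
  finally show "measure cantor_measure {Y. pref Y n = \<rho>} = (1/2) ^ n" by (simp add: measure_def)
qed

text \<open>The set is a finite disjoint union of cylinders, which turns counts of strings such as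
  \<open>cost\<close> into measures.\<close>

lemma clopen:
  shows sets_clopen: "{Y. P (pref Y n)} \<in> sets cantor_measure"
    and measure_clopen: "measure cantor_measure {Y. P (pref Y n)} = card {\<rho>. length \<rho> = n \<and> P \<rho>} / 2 ^ n"
proof -
  interpret prob_space cantor_measure by (rule prob_space_cantor_measure)
  have eq: "{Y. P (pref Y n)} = (\<Union>\<rho>\<in>{\<rho>. length \<rho> = n \<and> P \<rho>}. {Y. pref Y n = \<rho>})" by auto
  show "{Y. P (pref Y n)} \<in> sets cantor_measure"
    unfolding eq by (intro sets.finite_UN finite_strings cylinder(1)) auto
  have "measure cantor_measure {Y. P (pref Y n)} =
      (\<Sum>\<rho>\<in>{\<rho>. length \<rho> = n \<and> P \<rho>}. measure cantor_measure {Y. pref Y n = \<rho>})"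
    unfolding eq
    by (intro finite_measure_finite_Union finite_strings)
      (auto simp: disjoint_family_on_def intro: cylinder(1))
  also have "\<dots> = card {\<rho>. length \<rho> = n \<and> P \<rho>} / 2 ^ n"
    by (simp add: cylinder(2) power_one_over)
  finally show "measure cantor_measure {Y. P (pref Y n)} = card {\<rho>. length \<rho> = n \<and> P \<rho>} / 2 ^ n" .
qed

text \<open>Continuity from above: the open sets \<open>V n\<close> decrease to the null class, so
  their measures tend to 0, and \<open>cost k n s / 2 ^ s\<close> is the measure of a clopen subset
  of \<open>V n\<close>.\<close>

lemma (in acceptance) cheap_if_null:
  assumes "{Y. \<forall>n. \<exists>s. crosses k n (pref Y s)} \<in> null_sets cantor_measure"
  shows "\<exists>n0. \<forall>n\<ge>n0. \<forall>s. cost k n s * D \<le> 2 ^ s"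
proof -
  interpret prob_space cantor_measure by (rule prob_space_cantor_measure)
  define V where "V n = (\<Union>s. {Y. crosses k n (pref Y s)})" for n
  have V: "V n \<in> sets cantor_measure" for n
    unfolding V_def by (intro sets.countable_UN) (auto intro: sets_clopen)
  have "decseq V"
    unfolding decseq_def V_def by (auto intro: crosses_pref_mono)
  then have "(\<lambda>n. prob (V n)) \<longlonglongrightarrow> prob (\<Inter>n. V n)"
    by (intro finite_Lim_measure_decseq) (auto simp: V)
  also have "(\<Inter>n. V n) = {Y. \<forall>n. \<exists>s. crosses k n (pref Y s)}" by (auto simp: V_def)
  \<comment> \<open>Below, \<open>D + 1\<close> in the denominator keeps the bound positive also for
    \<open>D = 0\<close>.\<close>
  also have "prob \<dots> = 0" using assms by (simp add: null_sets_def measure_def)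
  finally have "\<forall>\<^sub>F n in sequentially. prob (V n) < 1 / (real D + 1)"
    by (rule order_tendstoD) simp
  then obtain n0 where n0: "\<And>n. n0 \<le> n \<Longrightarrow> prob (V n) < 1 / (real D + 1)"
    by (auto simp: eventually_sequentially)
  have "cost k n s * D \<le> 2 ^ s" if "n0 \<le> n" for n s
  proof -
    have "real (cost k n s) / 2 ^ s = prob {Y. crosses k n (pref Y s)}"
      by (simp add: measure_clopen cost_def length_filter_strings)
    also have "\<dots> \<le> prob (V n)" by (intro finite_measure_mono V) (auto simp: V_def)
    also have "\<dots> < 1 / (real D + 1)" by (rule n0[OF that])
    finally have "real (cost k n s) * (real D + 1) \<le> 2 ^ s" by (simp add: field_simps)
    moreover have "real (cost k n s * D) \<le> real (cost k n s) * (real D + 1)" by (simp add: algebra_simps)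
    ultimately have "real (cost k n s * D) \<le> real (2 ^ s)" by simp
    then show ?thesis unfolding of_nat_le_iff .
  qed
  then show ?thesis by blast
qed

section \<open>The dichotomy inside the Scott set\<close>

theorem theorem2:
  assumes "scott_set S" and "A \<in> S"
  shows "(\<exists>X\<in>S. weakly_2_random_rel A X) \<or> (\<exists>X\<in>S. one_generic_rel A X)"
proof -
  interpret acceptance A "accepts A"
  proof
    show "computable A (\<lambda>q. accepts A (fst q) (fst (snd q)) (snd (snd q)))" by (intro comp_intros)
  qed (rule accepts_mono)
  \<comment> \<open>One path serves all indices at once, since the tree avoids the bad strings of
    every \<open>k\<close>.\<close>
  obtain X where X: "X \<in> S" "is_path X good_tree"
    using assms binary_tree_good_tree infinite_good_tree turing_red_good_tree
    unfolding scott_set_def by blast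
  show ?thesis
  proof (cases "weakly_2_random_rel A X")
    case True
    then show ?thesis using X(1) by blast
  next
    case False
    then obtain R where R: "turing_red R A" "pi02_class R \<in> null_sets cantor_measure" "X \<in> pi02_class R"
      unfolding weakly_2_random_rel_def is_pi02_rel_def by blast
    then obtain f where f: "\<And>z. eval A f [z] (if R z then 1 else 0)" unfolding turing_red_def by blast
    \<comment> \<open>The program deciding \<open>R\<close> doubles as an index of the class: it
      outputs 1 exactly on the members of \<open>R\<close>.\<close>
    let ?k = "recf_code f"
    have "R z \<longleftrightarrow> (\<exists>s. accepts A s ?k z)" for z
      unfolding accepts_iff_eval using f[of z] eval_deterministic[OF f[of z], of 1] by (auto split: if_splits)
    then have pi02: "pi02_class R = {Y. \<forall>n. \<exists>s. crosses ?k n (pref Y s)}"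
      unfolding crosses_pref_iff pi02_class_def by simp
    have cross: "\<exists>s. crosses ?k n (pref X s)" for n using R(3) unfolding pi02 by blast
    let ?H = "generic ?k X"
    have "turing_red ?H (join X A)"
      using computable_generic[OF cross] by (simp add: computable_iff_turing_red)
    then have "?H \<in> S" using assms X(1) unfolding scott_set_def by blast
    moreover have "one_generic_rel A ?H"
      unfolding one_generic_rel_def
    proof (intro allI impI)
      fix W assume "ce_in A W"
      then obtain g where g: "\<And>\<sigma>. \<sigma> \<in> W \<longleftrightarrow> (\<exists>y. eval A g [bl_code \<sigma>] y)" unfolding ce_in_def by blast
      \<comment> \<open>Halting of \<open>g\<close> becomes output 1: \<open>Comp\<close> still
        requires \<open>g\<close> to converge, \<open>Zer\<close> discards its value and
        \<open>Suc_f\<close> yields 1.\<close>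
      let ?g = "Comp Suc_f [Comp Zer [g]]"
      have "eval A ?g [x] 1 \<longleftrightarrow> (\<exists>y. eval A g [x] y)" for x
      proof
        show "\<exists>y. eval A g [x] y" if "eval A ?g [x] 1"
          using that by (force elim!: eval_CompE simp: list_all2_Cons1)
        show "eval A ?g [x] 1" if "\<exists>y. eval A g [x] y"
        proof -
          from that obtain y where "eval A g [x] y" ..
          from eval_Comp1[OF eval_Comp1[OF this eval.zer]] show ?thesis by (simp add: eval_Suc_f)
        qed
      qed
      then have W: "\<sigma> \<in> W \<longleftrightarrow> (\<exists>s. accepts A s (recf_code ?g) (bl_code \<sigma>))" for \<sigma>
        by (simp only: g accepts_iff_eval)
      have "(\<exists>n s. accepts A s (recf_code ?g) (bl_code (pref ?H n))) \<or>
        (\<exists>n. \<forall>\<tau> s. accepts A s (recf_code ?g) (bl_code \<tau>) \<longrightarrow> \<not> (\<exists>\<rho>. \<tau> = pref ?H n @ \<rho>))"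
        using path_avoids_bad[OF X(2)] cross cheap_if_null[OF R(2)[unfolded pi02]]
        by (rule generic_meets_or_avoids)
      then show "(\<exists>n. pref ?H n \<in> W) \<or> (\<exists>n. \<forall>\<tau>\<in>W. \<not> (\<exists>\<rho>. \<tau> = pref ?H n @ \<rho>))"
        unfolding Ball_def W by blast
    qed
    ultimately show ?thesis by blast
  qed
qed

end
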